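(* Let $H$ be one of the following graphs: the triangle, the paw, the claw, the diamond. Then every $(2K_2, H)$-free graph is recolorable.
   Context: All graphs are finite and simple. A $k$-coloring of $G$ is a map $V(G)\to\{1,\dots,k\}$ giving adjacent vertices different values; $\chi(G)$ is the chromatic number. $R_k(G)$ denotes the graph whose vertices are the $k$-colorings of $G$, two being adjacent if they differ in color on exactly one vertex. $G$ is recolorable if $R_\ell(G)$ is connected for all $\ell\ge\chi(G)+1$. A graph is $(H_1,\dots,H_r)$-free if it has no induced subgraph isomorphic to any $H_i$. $2K_2$ is the disjoint union of two edges; the triangle is $K_3$; the paw is a triangle together with one extra vertex adjacent to exactly one vertex of the triangle; the claw is $K_{1,3}$; the diamond is $K_4$ minus an edge. *)

theory Defs
  imports "Graph_Theory.Graph_Theory" "HOL-Library.FuncSet"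
begin

text \<open>
  Finite simple graphs are rendered by the locale \<^locale>\<open>pair_graph\<close>: finite, loopfree
  digraphs without parallel arcs whose arc relation is symmetric. An edge between \<open>u\<close> and \<open>v\<close>
  is the pair of arcs \<open>(u, v)\<close> and \<open>(v, u)\<close>.
\<close>

definition graph_of :: "'a set \<Rightarrow> ('a \<times> 'a) set \<Rightarrow> 'a pair_pre_digraph" where
  "graph_of V E = \<lparr> pverts = V, parcs = E \<union> E\<inverse> \<rparr>"

definition two_K2 :: "nat pair_pre_digraph" where
  "two_K2 = graph_of {0, 1, 2, 3} {(0, 1), (2, 3)}"

definition triangle_graph :: "nat pair_pre_digraph" where
  "triangle_graph = graph_of {0, 1, 2} {(0, 1), (0, 2), (1, 2)}"

definition paw_graph :: "nat pair_pre_digraph" where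
  "paw_graph = graph_of {0, 1, 2, 3} {(0, 1), (0, 2), (1, 2), (0, 3)}"

definition claw_graph :: "nat pair_pre_digraph" where
  "claw_graph = graph_of {0, 1, 2, 3} {(0, 1), (0, 2), (0, 3)}"

definition diamond_graph :: "nat pair_pre_digraph" where
  "diamond_graph = graph_of {0, 1, 2, 3} {(0, 1), (0, 2), (1, 2), (0, 3), (1, 3)}"

definition has_induced_copy :: "'a pair_pre_digraph \<Rightarrow> 'b pair_pre_digraph \<Rightarrow> bool" where
  "has_induced_copy G H \<longleftrightarrow>
     (\<exists>S. induced_subgraph S (with_proj G) \<and> digraph_iso (with_proj H) S)"

definition free_of :: "'b pair_pre_digraph set \<Rightarrow> 'a pair_pre_digraph \<Rightarrow> bool" where
  "free_of Hs G \<longleftrightarrow> (\<forall>H \<in> Hs. \<not> has_induced_copy G H)"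

text \<open>
  Colorings are extensional (\<open>undefined\<close> outside the vertex set), so that two colorings are
  equal exactly if they agree on all vertices.
\<close>

definition colorings :: "nat \<Rightarrow> 'a pair_pre_digraph \<Rightarrow> ('a \<Rightarrow> nat) set" where
  "colorings k G = {c \<in> pverts G \<rightarrow>\<^sub>E {1..k}. \<forall>(u, v) \<in> parcs G. c u \<noteq> c v}"

definition chromatic_number :: "'a pair_pre_digraph \<Rightarrow> nat" where
  "chromatic_number G = (LEAST k. colorings k G \<noteq> {})"

definition recoloring_graph :: "nat \<Rightarrow> 'a pair_pre_digraph \<Rightarrow> ('a \<Rightarrow> nat) pair_pre_digraph" where
  "recoloring_graph k G =
     \<lparr> pverts = colorings k G,
       parcs = {(c, d). c \<in> colorings k G \<and> d \<in> colorings k G \<and>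
                        (\<exists>!v. v \<in> pverts G \<and> c v \<noteq> d v)} \<rparr>"

definition recolorable :: "'a pair_pre_digraph \<Rightarrow> bool" where
  "recolorable G \<longleftrightarrow>
     (\<forall>l \<ge> chromatic_number G + 1.
        Digraph_Component.connected (with_proj (recoloring_graph l G)))"

lemma pair_graph_graph_of:
  assumes "finite V" "E \<subseteq> V \<times> V" "\<forall>(u, v) \<in> E. u \<noteq> v"
  shows "pair_graph (graph_of V E)"
proof -
  have "finite E"
    using assms finite_subset by blast
  then show ?thesis
    using assms by unfold_locales (auto simp: graph_of_def symmetric_def sym_def)
qed

lemma pair_graph_small:
  "pair_graph two_K2" "pair_graph triangle_graph" "pair_graph paw_graph"
  "pair_graph claw_graph" "pair_graph diamond_graph"
  unfolding two_K2_def triangle_graph_def paw_graph_def claw_graph_def diamond_graph_def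
  by (rule pair_graph_graph_of; auto)+

lemma complete_triangle: "K\<^bsub>3\<^esub> (with_proj triangle_graph)"
  unfolding complete_digraph_pair_def by (auto simp: triangle_graph_def graph_of_def)

lemma complete_bipartite_claw: "K\<^bsub>1,3\<^esub> (with_proj claw_graph)"
  unfolding complete_bipartite_digraph_pair_def
  by (simp add: claw_graph_def graph_of_def, rule exI[of _ "{0}"], rule exI[of _ "{1, 2, 3}"]) auto

lemma colorings_chromatic_number:
  assumes "pair_graph G"
  shows "colorings (chromatic_number G) G \<noteq> {}"
proof -
  interpret pair_graph G by fact
  obtain f :: "'a \<Rightarrow> nat" and n where f: "f ` pverts G = {i. i < n}" "inj_on f (pverts G)"
    using finite_imp_inj_to_nat_seg[OF pair_finite_verts] by metis
  have "restrict (Suc \<circ> f) (pverts G) \<in> pverts G \<rightarrow>\<^sub>E {1..n}"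
  proof (rule restrict_PiE_iff[THEN iffD2], rule ballI)
    fix v assume "v \<in> pverts G"
    then have "f v \<in> {i. i < n}"
      using f(1) by (metis imageI)
    then show "(Suc \<circ> f) v \<in> {1..n}"
      by simp
  qed
  moreover have "f u \<noteq> f v" "u \<in> pverts G" "v \<in> pverts G" if "(u, v) \<in> parcs G" for u v
    using inj_onD[OF f(2) _ in_arcsD1[OF that] in_arcsD2[OF that]]
      in_arcsD1[OF that] in_arcsD2[OF that] pair_no_loops[OF that]
    by fastforce+
  ultimately have "restrict (Suc \<circ> f) (pverts G) \<in> colorings n G"
    by (simp add: colorings_def case_prod_beta')
  then have "colorings n G \<noteq> {}"
    by blast
  then show ?thesis
    unfolding chromatic_number_def by (rule LeastI)
qed

lemma pair_graph_recoloring_graph: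
  assumes "pair_graph G"
  shows "pair_graph (recoloring_graph k G)"
proof -
  interpret pair_graph G by fact
  have fin: "finite (colorings k G)"
    unfolding colorings_def using pair_finite_verts by (simp add: finite_PiE)
  have "finite (parcs (recoloring_graph k G))"
    by (rule finite_subset[of _ "colorings k G \<times> colorings k G"])
       (auto simp: recoloring_graph_def fin)
  moreover have "sym (parcs (recoloring_graph k G))"
  proof (rule symI)
    fix c d assume "(c, d) \<in> parcs (recoloring_graph k G)"
    then have cd: "c \<in> colorings k G" "d \<in> colorings k G" "\<exists>!v. v \<in> pverts G \<and> c v \<noteq> d v"
      by (auto simp: recoloring_graph_def)
    have "(\<lambda>v. v \<in> pverts G \<and> d v \<noteq> c v) = (\<lambda>v. v \<in> pverts G \<and> c v \<noteq> d v)"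
      by metis
    with cd show "(d, c) \<in> parcs (recoloring_graph k G)"
      by (simp add: recoloring_graph_def)
  qed
  ultimately show ?thesis
    using fin by unfold_locales (auto simp: recoloring_graph_def symmetric_def)
qed

end

theory Submission
  imports Defs
begin

text \<open>
  Fix a set of colors in which one color more is available than some proper coloring uses. A vertex
  \<open>u\<close> whose neighborhood is contained in that of a nonadjacent vertex \<open>v\<close> can follow the color of
  \<open>v\<close>, and a vertex with degree at most the number of colors minus two can always step aside. Both
  kinds of vertices may hence be deleted, and in a minimal graph no such vertex exists. With
  \<open>2K\<^sub>2\<close>-freeness this leaves few graphs. Triangle-free and paw-free graphs reduce to nothing. Claw-free
  graphs reduce to graphs without independent triples, whose colorings are matchings of the complement
  and are handled by exchanging matching edges. Diamond-free graphs reduce to graphs without independent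
  triples or to the circular clique \<open>K\<^bsub>9/3\<^esub>\<close>, which is handled directly. In the last two cases the
  induction peels off an independent set that is made a color class.
\<close>

section \<open>Recoloring with a fixed set of colors\<close>

text \<open>The induction ranges over arbitrary finite sets of colors instead of the intervals
  \<open>{1..l}\<close>, because peeling off a class removes a color that cannot be prescribed. The
  hypothesis \<open>excess\<close> stands for l \<ge> \<chi> + 1: it passes to subgraphs, and it
  survives the removal of any one color together with a class of a coloring that leaves a color
  spare. An irreducible vertex has degree at least |C| - 1, hence at least the size of every clique.
  Most contradictions therefore come from a clique exceeding some degree, or from an induced 2K2
  built from private neighbors: since no vertex folds into a nonadjacent one, each has a neighbor
  that the other lacks. Deletion alone cannot finish: K_{9/3} has degree 4 and is irreducible with
  four or five colors. Peeling replaces connectedness by the task of driving every coloring to one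
  in which a fixed independent set is exactly a color class.\<close>

locale sgraph =
  fixes E :: "'a \<Rightarrow> 'a \<Rightarrow> bool"
  assumes E_sym: "E u v \<Longrightarrow> E v u"
    and E_irrefl [simp]: "\<not> E u u"
begin

lemma E_commute: "E u v \<longleftrightarrow> E v u"
  using E_sym by blast

text \<open>
  Colorings are total functions of which only the values on the vertex set matter. A step may
  leave the coloring unchanged on the vertex set, which makes \<open>step\<close> reflexive on colorings.
\<close>

definition col :: "'a set \<Rightarrow> nat set \<Rightarrow> ('a \<Rightarrow> nat) \<Rightarrow> bool" where
  "col V C c \<longleftrightarrow> c ` V \<subseteq> C \<and> (\<forall>u\<in>V. \<forall>v\<in>V. E u v \<longrightarrow> c u \<noteq> c v)"

definition step :: "'a set \<Rightarrow> nat set \<Rightarrow> ('a \<Rightarrow> nat) \<Rightarrow> ('a \<Rightarrow> nat) \<Rightarrow> bool" where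
  "step V C c d \<longleftrightarrow> col V C c \<and> col V C d \<and> (\<exists>v. \<forall>u\<in>V. u \<noteq> v \<longrightarrow> c u = d u)"

abbreviation reach :: "'a set \<Rightarrow> nat set \<Rightarrow> ('a \<Rightarrow> nat) \<Rightarrow> ('a \<Rightarrow> nat) \<Rightarrow> bool" where
  "reach V C \<equiv> (step V C)\<^sup>*\<^sup>*"

definition conn :: "'a set \<Rightarrow> nat set \<Rightarrow> bool" where
  "conn V C \<longleftrightarrow> (\<forall>c d. col V C c \<longrightarrow> col V C d \<longrightarrow> reach V C c d)"

definition excess :: "'a set \<Rightarrow> nat set \<Rightarrow> bool" where
  "excess V C \<longleftrightarrow> (\<exists>D. D \<subset> C \<and> (\<exists>c. col V D c))"

definition nbrs :: "'a set \<Rightarrow> 'a \<Rightarrow> 'a set" where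
  "nbrs V v = {w \<in> V. E v w}"

lemma nbrs_subset: "nbrs V v \<subseteq> V - {v}"
  by (auto simp: nbrs_def)

lemma finite_nbrs: "finite V \<Longrightarrow> finite (nbrs V v)"
  by (simp add: nbrs_def)

lemma colI: "(\<And>v. v \<in> V \<Longrightarrow> c v \<in> C) \<Longrightarrow>
    (\<And>u v. u \<in> V \<Longrightarrow> v \<in> V \<Longrightarrow> E u v \<Longrightarrow> c u \<noteq> c v) \<Longrightarrow> col V C c"
  by (auto simp: col_def)

lemma colD: "col V C c \<Longrightarrow> v \<in> V \<Longrightarrow> c v \<in> C"
  by (auto simp: col_def)

lemma col_neq: "col V C c \<Longrightarrow> u \<in> V \<Longrightarrow> v \<in> V \<Longrightarrow> E u v \<Longrightarrow> c u \<noteq> c v"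
  by (auto simp: col_def)

lemma col_subset: "col V C c \<Longrightarrow> W \<subseteq> V \<Longrightarrow> C \<subseteq> C' \<Longrightarrow> col W C' c"
  unfolding col_def by (meson image_mono order_trans subsetD)

lemma col_cong: "(\<And>v. v \<in> V \<Longrightarrow> c v = d v) \<Longrightarrow> col V C c \<longleftrightarrow> col V C d"
  by (auto simp: col_def)

lemma stepI:
  "col V C c \<Longrightarrow> col V C d \<Longrightarrow> (\<And>u. u \<in> V \<Longrightarrow> u \<noteq> v \<Longrightarrow> c u = d u) \<Longrightarrow> step V C c d"
  by (auto simp: step_def)

lemma step_sym: "step V C c d \<Longrightarrow> step V C d c"
  by (fastforce simp: step_def)

lemma reach_sym: "reach V C c d \<Longrightarrow> reach V C d c"
  by (induction rule: rtranclp_induct) (auto intro: step_sym converse_rtranclp_into_rtranclp)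

lemma reach_col: "reach V C c d \<Longrightarrow> col V C c \<Longrightarrow> col V C d"
  by (induction rule: rtranclp_induct) (auto simp: step_def)

lemma reach_cong:
  assumes "col V C c" "\<And>v. v \<in> V \<Longrightarrow> c v = d v"
  shows "reach V C c d"
  using assms col_cong[of V c d C] by (auto intro!: r_into_rtranclp stepI)

text \<open>Since the end coloring is proper, \<open>T \<inter> V\<close> is independent. Every
  stage in which only part of \<open>T\<close> has changed then mixes two proper colorings without
  conflict, so the vertices may change in any order.\<close>

lemma recolor_set:
  assumes "finite T" "col V C c" "col V C (\<lambda>w. if w \<in> T then j else c w)"
  shows "reach V C c (\<lambda>w. if w \<in> T then j else c w)"
proof -
  have "reach V C c (\<lambda>w. if w \<in> T' then j else c w)" if "T' \<subseteq> T" for T'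
    using finite_subset[OF that assms(1)] that
  proof (induction T' rule: finite_induct)
    case empty
    then show ?case by simp
  next
    case (insert x T')
    have col: "col V C (\<lambda>w. if w \<in> U then j else c w)" if "U \<subseteq> T" for U
    proof (rule colI)
      show "(if v \<in> U then j else c v) \<in> C" if "v \<in> V" for v
        using colD[OF assms(2) that] colD[OF assms(3) that] \<open>U \<subseteq> T\<close> by auto
      show "(if u \<in> U then j else c u) \<noteq> (if v \<in> U then j else c v)"
        if "u \<in> V" "v \<in> V" "E u v" for u v
        using col_neq[OF assms(2) that] col_neq[OF assms(3) that] \<open>U \<subseteq> T\<close>
        by (auto split: if_splits)
    qed
    have "step V C (\<lambda>w. if w \<in> T' then j else c w) (\<lambda>w. if w \<in> insert x T' then j else c w)"
      using insert.prems by (intro stepI[of _ _ _ _ x] col) auto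
    with insert show ?case
      by (meson insert_subset rtranclp.rtrancl_into_rtrancl)
  qed
  then show ?thesis
    by blast
qed

section \<open>Spare colors and the deletion of vertices\<close>

lemma conn_empty: "conn {} C"
  by (auto simp: conn_def intro!: r_into_rtranclp stepI)

lemma excess_subset: "excess V C \<Longrightarrow> W \<subseteq> V \<Longrightarrow> excess W C"
  using col_subset[of V _ _ W] unfolding excess_def by (meson order_refl)

lemma col_recolor:
  assumes "col V D c" "finite D" "finite D'" "card D \<le> card D'"
  shows "\<exists>c'. col V D' c'"
proof -
  obtain f where f: "inj_on f D" "f ` D \<subseteq> D'"
    using assms card_le_inj by metis
  have "col V D' (f \<circ> c)"
    using f colD[OF assms(1)] col_neq[OF assms(1)]
    by (intro colI) (auto simp: inj_on_eq_iff)
  then show ?thesis by (intro exI[of _ "f \<circ> c"])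
qed

text \<open>Renaming colors injectively moves a coloring into a proper subset of \<open>C\<close>,
  so only the number of colors counts and \<open>D\<close> may even be disjoint from
  \<open>C\<close>.\<close>

lemma excessI:
  assumes "col V D c" "finite D" "finite C" "card D < card C"
  shows "excess V C"
proof -
  obtain D' where "D' \<subseteq> C" "card D' = card D"
    using assms(4) by (meson obtain_subset_with_card_n order_less_imp_le)
  then show ?thesis
    using assms col_recolor[of V D c D'] finite_subset[of D' C] unfolding excess_def
    by (intro exI[of _ D']) auto
qed

lemma excess_card:
  assumes "excess V C" "finite C"
  obtains D c where "col V D c" "finite D" "D \<subseteq> C" "card D < card C"
proof -
  obtain D c where "D \<subset> C" "col V D c"
    using assms(1) unfolding excess_def by blast
  then show thesis
    using that psubset_card_mono[OF assms(2)] finite_subset[OF _ assms(2)] by (meson psubset_imp_subset)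
qed

text \<open>Removing all vertices of color \<open>i\<close> saves one color of \<open>D\<close>,
  while passing from \<open>C\<close> to \<open>C'\<close> costs at most one, so the surplus
  persists.\<close>

lemma excess_peel:
  assumes "col V D c" "S \<subseteq> V" "\<And>v. v \<in> V - S \<Longrightarrow> c v \<noteq> i" "i \<in> D"
    "finite C" "card D < card C" "finite D" "card C \<le> Suc (card C')" "finite C'"
  shows "excess (V - S) C'"
proof (rule excessI)
  show "col (V - S) (D - {i}) c"
    using assms(1,3) by (auto simp: col_def)
  show "card (D - {i}) < card C'"
    using assms(4,6,7,8) card_Suc_Diff1[of D i] by simp
qed (use assms in auto)

text \<open>Copying the color of \<open>v\<close> onto \<open>u\<close> is always legal, because
  every neighbor of \<open>u\<close> is a neighbor of \<open>v\<close>. A path for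
  \<open>V - {u}\<close> is lifted by letting \<open>u\<close> follow \<open>v\<close> one step
  behind.\<close>

lemma conn_fold:
  assumes "u \<in> V" "v \<in> V" "u \<noteq> v" "\<not> E u v" "\<And>w. w \<in> V \<Longrightarrow> E u w \<Longrightarrow> E v w"
    and conn: "conn (V - {u}) C"
  shows "conn V C"
proof -
  \<comment> \<open>Here \<open>d v\<close> is the color of \<open>v\<close> at an adjacent stage. A
    neighbor \<open>w\<close> of \<open>u\<close> other than \<open>x\<close> has
    \<open>c w = d w\<close>; if \<open>w\<close> is \<open>x\<close>, then \<open>v\<close> did not
    move and \<open>d v = c v\<close>. In both cases \<open>c w\<close> differs from
    \<open>d v\<close>.\<close>
  have ext: "col V C (c(u := d v))"
    if "col (V - {u}) C c" "col (V - {u}) C d" "\<forall>w\<in>V. w \<noteq> x \<longrightarrow> w \<noteq> u \<longrightarrow> c w = d w" for c d x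
  proof (rule colI)
    show "(c(u := d v)) w \<in> C" if "w \<in> V" for w
      using colD[OF \<open>col (V - {u}) C c\<close>, of w] colD[OF \<open>col (V - {u}) C d\<close>, of v] that assms
      by auto
    have *: "c w \<noteq> d v" if "w \<in> V" "E u w" for w
    proof -
      have "E v w" "w \<noteq> v" "w \<noteq> u"
        using that assms by auto
      then show ?thesis
        using col_neq[OF \<open>col (V - {u}) C c\<close>, of v w] col_neq[OF \<open>col (V - {u}) C d\<close>, of v w]
          that(1) assms(2,3) \<open>\<forall>w\<in>V. w \<noteq> x \<longrightarrow> w \<noteq> u \<longrightarrow> c w = d w\<close>
        by (cases "w = x") auto
    qed
    show "(c(u := d v)) w \<noteq> (c(u := d v)) w'" if "w \<in> V" "w' \<in> V" "E w w'" for w w'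
      using * col_neq[OF \<open>col (V - {u}) C c\<close>, of w w'] that E_sym[of w w']
      by (cases "w = u"; cases "w' = u") (auto, metis)
  qed
  have lift: "reach V C (c(u := c v)) (d(u := d v))"
    if "reach (V - {u}) C c d" "col (V - {u}) C c" for c d
    using that
  proof (induction rule: rtranclp_induct)
    case base
    then show ?case by simp
  next
    case (step d e)
    then obtain x where d: "col (V - {u}) C d" and e: "col (V - {u}) C e"
      and x: "\<forall>w\<in>V. w \<noteq> x \<longrightarrow> w \<noteq> u \<longrightarrow> d w = e w"
      unfolding step_def by auto
    have x': "\<forall>w\<in>V. w \<noteq> x \<longrightarrow> w \<noteq> u \<longrightarrow> e w = d w"
      using x by auto
    have "step V C (d(u := d v)) (e(u := d v))"
      using x by (intro stepI[of _ _ _ _ x] ext[OF d d] ext[OF e d x']) auto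
    moreover have "step V C (e(u := d v)) (e(u := e v))"
      by (intro stepI[of _ _ _ _ u] ext[OF e e] ext[OF e d x']) auto
    ultimately show ?case
      using step.IH step.prems by (meson rtranclp.rtrancl_into_rtrancl)
  qed
  have proj: "reach V C c (c(u := c v))" "col (V - {u}) C c" if "col V C c" for c
  proof -
    show c: "col (V - {u}) C c"
      using that col_subset by (metis Diff_subset order_refl)
    show "reach V C c (c(u := c v))"
      using ext[OF c c] that by (intro r_into_rtranclp stepI[of _ _ _ _ u]) auto
  qed
  show ?thesis
    unfolding conn_def
  proof (intro allI impI)
    fix c d assume c: "col V C c" and d: "col V C d"
    then have "reach V C (c(u := c v)) (d(u := d v))"
      using conn proj(2) by (intro lift) (auto simp: conn_def)
    then show "reach V C c d"
      using proj(1)[OF c] reach_sym[OF proj(1)[OF d]] by (meson rtranclp_trans)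
  qed
qed

text \<open>Before a vertex \<open>x\<close> moves to its new color \<open>e x\<close>, the vertex
  \<open>v\<close> steps aside. Its neighbors show at most deg(v) colors, and the move can only add
  \<open>e x\<close>, so \<open>v\<close> has to avoid at most deg(v) + 1 colors and one
  remains.\<close>

lemma conn_low_degree:
  assumes "finite V" "v \<in> V" "finite C" "card (nbrs V v) + 2 \<le> card C"
    and conn: "conn (V - {v}) C"
  shows "conn V C"
proof -
  have lift: "\<exists>d'. col V C d' \<and> (\<forall>w\<in>V - {v}. d' w = d w) \<and> reach V C c d'"
    if "reach (V - {v}) C c d" "col V C c" for c d
    using that
  proof (induction rule: rtranclp_induct)
    case base
    then show ?case by (intro exI[of _ c]) simp
  next
    case (step d e)
    then obtain d' where d': "col V C d'" "\<forall>w\<in>V - {v}. d' w = d w" "reach V C c d'"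
      by blast
    obtain x where x: "\<forall>w\<in>V. w \<noteq> x \<longrightarrow> w \<noteq> v \<longrightarrow> d w = e w" and e: "col (V - {v}) C e"
      using step.hyps(2) unfolding step_def by auto
    have "d' ` nbrs V v \<union> e ` nbrs V v \<subseteq> insert (e x) (d' ` nbrs V v)"
    proof -
      have "e w \<in> insert (e x) (d' ` nbrs V v)" if "w \<in> nbrs V v" for w
      proof (cases "w = x")
        case False
        then have "e w = d' w"
          using that x d'(2) by (cases "w = v") (auto simp: nbrs_def)
        then show ?thesis
          using that by auto
      qed auto
      then show ?thesis by auto
    qed
    then have "card (d' ` nbrs V v \<union> e ` nbrs V v) \<le> card (insert (e x) (d' ` nbrs V v))"
      using finite_nbrs[OF assms(1)] by (intro card_mono) auto
    also have "\<dots> \<le> Suc (card (d' ` nbrs V v))"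
      using finite_nbrs[OF assms(1)] by (simp add: card_insert_if)
    also have "\<dots> \<le> Suc (card (nbrs V v))"
      using card_image_le[OF finite_nbrs[OF assms(1)]] by simp
    finally have "card (d' ` nbrs V v \<union> e ` nbrs V v) < card C"
      using assms(4) by simp
    then obtain a where a: "a \<in> C" "a \<notin> d' ` nbrs V v" "a \<notin> e ` nbrs V v"
      using card_mono[of "d' ` nbrs V v \<union> e ` nbrs V v" C] finite_nbrs[OF assms(1)]
      by (metis UnCI finite_UnI finite_imageI leD subsetI)
    have ext: "col V C (f(v := a))" if "col (V - {v}) C f" "a \<notin> f ` nbrs V v" for f
    proof (rule colI)
      show "(f(v := a)) w \<in> C" if "w \<in> V" for w
        using colD[OF \<open>col (V - {v}) C f\<close>, of w] that a by auto
      show "(f(v := a)) w \<noteq> (f(v := a)) w'" if "w \<in> V" "w' \<in> V" "E w w'" for w w'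
        using col_neq[OF \<open>col (V - {v}) C f\<close>, of w w'] that E_sym[OF that(3)] \<open>a \<notin> f ` nbrs V v\<close>
        by (cases "w = v"; cases "w' = v") (auto simp: nbrs_def)
    qed
    have "col (V - {v}) C d'"
      using d'(1) col_subset by (metis Diff_subset order_refl)
    then have 1: "col V C (d'(v := a))"
      using ext a by blast
    have 2: "col V C (e(v := a))"
      using ext e a by blast
    have "step V C d' (d'(v := a))"
      using d'(1) 1 by (intro stepI[of _ _ _ _ v]) auto
    moreover have "step V C (d'(v := a)) (e(v := a))"
      using d'(2) x 1 2 by (intro stepI[of _ _ _ _ x]) auto
    ultimately have "reach V C c (e(v := a))"
      using d'(3) by (meson rtranclp.rtrancl_into_rtrancl)
    moreover have "\<forall>w\<in>V - {v}. (e(v := a)) w = e w"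
      by simp
    ultimately show ?case
      using 2 by blast
  qed
  show ?thesis
    unfolding conn_def
  proof (intro allI impI)
    fix c d assume c: "col V C c" and d: "col V C d"
    then have "reach (V - {v}) C c d"
      using conn col_subset unfolding conn_def by (metis Diff_subset order_refl)
    from lift[OF this c] obtain d' where d': "col V C d'" "\<forall>w\<in>V - {v}. d' w = d w" "reach V C c d'"
      by blast
    then have "step V C d' d"
      using d by (intro stepI[of _ _ _ _ v]) auto
    with d'(3) show "reach V C c d"
      by (meson rtranclp.rtrancl_into_rtrancl)
  qed
qed

section \<open>Peeling off a color class\<close>

lemma reach_same_class:
  assumes "i \<in> C" and conn: "conn (V - S) (C - {i})"
    and c: "col V C c" "\<And>w. w \<in> V \<Longrightarrow> c w = i \<longleftrightarrow> w \<in> S"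
    and d: "col V C d" "\<And>w. w \<in> V \<Longrightarrow> d w = i \<longleftrightarrow> w \<in> S"
  shows "reach V C c d"
proof -
  define ext where "ext f = (\<lambda>w. if w \<in> S then i else f w)" for f :: "'a \<Rightarrow> nat"
  \<comment> \<open>The colorings of \<open>V - S\<close> never use \<open>i\<close>, and
    \<open>S\<close> is independent as a color class of \<open>c\<close>; painting \<open>S\<close>
    with \<open>i\<close> therefore extends each of them, and each step between them.\<close>
  have col_ext: "col V C (ext f)" if f: "col (V - S) (C - {i}) f" for f
  proof (rule colI)
    show "ext f v \<in> C" if "v \<in> V" for v
      using colD[OF f, of v] that assms(1) by (auto simp: ext_def)
    show "ext f u \<noteq> ext f v" if "u \<in> V" "v \<in> V" "E u v" for u v
      using colD[OF f, of u] colD[OF f, of v] col_neq[OF f, of u v] col_neq[OF c(1) that]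
        c(2)[of u] c(2)[of v] that by (cases "u \<in> S"; cases "v \<in> S") (auto simp: ext_def)
  qed
  have lift: "reach V C (ext f) (ext g)" if "reach (V - S) (C - {i}) f g" for f g
    using that
  proof (induction rule: rtranclp_induct)
    case base
    then show ?case by simp
  next
    case (step g h)
    then have "step V C (ext g) (ext h)"
      using col_ext unfolding step_def by (auto simp: ext_def)
    with step.IH show ?case
      by (meson rtranclp.rtrancl_into_rtrancl)
  qed
  have restrict: "col (V - S) (C - {i}) f" "reach V C f (ext f)"
    if f: "col V C f" "\<And>w. w \<in> V \<Longrightarrow> f w = i \<longleftrightarrow> w \<in> S" for f
    using f by (auto simp: col_def ext_def intro!: reach_cong)
  have "reach V C (ext c) (ext d)"
    using conn restrict(1)[OF c] restrict(1)[OF d] by (intro lift) (simp add: conn_def)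
  then show ?thesis
    using restrict(2)[OF c] reach_sym[OF restrict(2)[OF d]] by (meson rtranclp_trans)
qed

text \<open>If \<open>S\<close> is a class of the same color in both colorings, they are joined
  inside \<open>V - S\<close>. For different colors \<open>i\<close> and \<open>j\<close> the path
  passes through a coloring of \<open>V - S\<close> that avoids both, where \<open>S\<close> can
  switch from \<open>i\<close> to \<open>j\<close>.\<close>

lemma conn_peel:
  assumes "finite V" "finite C" "S \<subseteq> V"
    and conn: "\<And>i. i \<in> C \<Longrightarrow> conn (V - S) (C - {i})"
    and exc: "\<And>i. i \<in> C \<Longrightarrow> excess (V - S) (C - {i})"
    and reach: "\<And>c. col V C c \<Longrightarrow> \<exists>d. reach V C c d \<and> (\<exists>i\<in>C. \<forall>w\<in>V. d w = i \<longleftrightarrow> w \<in> S)"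
  shows "conn V C"
proof -
  have main: "reach V C c d"
    if c: "col V C c" "\<forall>w\<in>V. c w = i \<longleftrightarrow> w \<in> S" and d: "col V C d" "\<forall>w\<in>V. d w = j \<longleftrightarrow> w \<in> S"
      and ij: "i \<in> C" "j \<in> C" for c d i j
  proof (cases "i = j")
    case True
    then show ?thesis
      using reach_same_class[OF ij(1) conn[OF ij(1)]] c d by simp
  next
    case False
    \<comment> \<open>The spare color of \<open>C - {i}\<close> pays for \<open>j\<close>: after
      renaming, \<open>V - S\<close> is colored without \<open>i\<close> and
      \<open>j\<close>.\<close>
    obtain D f where f: "col (V - S) D f" "finite D" "card D < card (C - {i})"
      using exc[OF ij(1)] assms(2) by (elim excess_card) auto
    then have "card D \<le> card (C - {i} - {j})"
      using False ij assms(2) by simp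
    then obtain g where g: "col (V - S) (C - {i} - {j}) g"
      using col_recolor[OF f(1,2), of "C - {i} - {j}"] assms(2) by auto
    define h where "h k = (\<lambda>w. if w \<in> S then k else g w)" for k
    have nS: "\<not> E u v" if "u \<in> S" "v \<in> S" for u v
      using col_neq[OF c(1), of u v] c(2) that assms(3) by (metis subsetD)
    have h: "col V C (h k)" "\<forall>w\<in>V. h k w = k \<longleftrightarrow> w \<in> S" if "k = i \<or> k = j" for k
    proof -
      have gk: "g v \<in> C \<and> g v \<noteq> k" if "v \<in> V - S" for v
        using colD[OF g that] \<open>k = i \<or> k = j\<close> by auto
      then show "\<forall>w\<in>V. h k w = k \<longleftrightarrow> w \<in> S"
        by (simp add: h_def)
      show "col V C (h k)"
      proof (rule colI)
        show "h k v \<in> C" if "v \<in> V" for v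
          using gk[of v] that \<open>k = i \<or> k = j\<close> ij by (auto simp: h_def)
        show "h k u \<noteq> h k v" if "u \<in> V" "v \<in> V" "E u v" for u v
          using gk[of u] gk[of v] col_neq[OF g, of u v] nS[of u v] that
          by (cases "u \<in> S"; cases "v \<in> S") (auto simp: h_def)
      qed
    qed
    have "reach V C c (h i)"
      using reach_same_class[OF ij(1) conn[OF ij(1)] c(1) _ h(1)] c(2) h(2) by simp
    moreover have "reach V C (h i) (h j)"
    proof -
      have eq: "h j = (\<lambda>w. if w \<in> S then j else h i w)"
        by (auto simp: h_def)
      show ?thesis
        using recolor_set[of S V C "h i" j] h(1) finite_subset[OF assms(3,1)]
        unfolding eq[symmetric] by blast
    qed
    moreover have "reach V C (h j) d"
      using reach_same_class[OF ij(2) conn[OF ij(2)] h(1) _ d(1)] d(2) h(2) by simp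
    ultimately show ?thesis
      by (meson rtranclp_trans)
  qed
  show ?thesis
    unfolding conn_def
  proof (intro allI impI)
    fix c d assume c: "col V C c" and d: "col V C d"
    obtain c' i where c': "reach V C c c'" "i \<in> C" "\<forall>w\<in>V. c' w = i \<longleftrightarrow> w \<in> S"
      using reach[OF c] by blast
    obtain d' j where d': "reach V C d d'" "j \<in> C" "\<forall>w\<in>V. d' w = j \<longleftrightarrow> w \<in> S"
      using reach[OF d] by blast
    have "reach V C c' d'"
      using main[OF reach_col[OF c'(1) c] c'(3) reach_col[OF d'(1) d] d'(3) c'(2) d'(2)] .
    then show "reach V C c d"
      using c'(1) reach_sym[OF d'(1)] by (meson rtranclp_trans)
  qed
qed

text \<open>A minimal counterexample admits neither deletion, which yields the private neighbors and
  the degree bound handed to the step. Connectedness of proper subsets is granted for every color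
  set with excess, because peeling changes the color set too.\<close>

lemma reduction_induct [consumes 4, case_names hereditary step]:
  assumes "finite V" "finite C" "P V" "excess V C"
    and hered: "\<And>V W. P V \<Longrightarrow> W \<subseteq> V \<Longrightarrow> P W"
    and step: "\<And>V C. \<lbrakk>finite V; finite C; V \<noteq> {}; P V; excess V C;
      \<And>u v. \<lbrakk>u \<in> V; v \<in> V; u \<noteq> v; \<not> E u v\<rbrakk> \<Longrightarrow> \<exists>w\<in>V. E u w \<and> \<not> E v w;
      \<And>v. v \<in> V \<Longrightarrow> card C \<le> Suc (card (nbrs V v));
      \<And>W C'. \<lbrakk>W \<subset> V; finite C'; excess W C'\<rbrakk> \<Longrightarrow> conn W C'\<rbrakk> \<Longrightarrow> conn V C"
  shows "conn V C"
  using assms(1-4)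
proof (induction V arbitrary: C rule: finite_psubset_induct)
  case (psubset V)
  have IH: "conn W C'" if "W \<subset> V" "finite C'" "excess W C'" for W C'
    using psubset.IH[OF that(1,2) _ that(3)] hered[OF psubset.prems(2), of W] that by auto
  have IH': "conn (V - {v}) C" if "v \<in> V" for v
    using IH[of "V - {v}" C] that psubset.prems excess_subset[of V C "V - {v}"] by auto
  show ?case
  proof (rule ccontr)
    assume neg: "\<not> conn V C"
    have "V \<noteq> {}"
      using neg conn_empty by auto
    moreover have "\<exists>w\<in>V. E u w \<and> \<not> E v w" if "u \<in> V" "v \<in> V" "u \<noteq> v" "\<not> E u v" for u v
      using conn_fold[OF that _ IH'[OF that(1)]] neg by blast
    moreover have "card C \<le> Suc (card (nbrs V v))" if "v \<in> V" for v
      using conn_low_degree[OF psubset.hyps that psubset.prems(1) _ IH'[OF that]] neg by force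
    ultimately show False
      using step[OF psubset.hyps psubset.prems(1) _ psubset.prems(2,3)] IH neg by blast
  qed
qed

section \<open>Graphs without independent triples\<close>

definition indep3_free :: "'a set \<Rightarrow> bool" where
  "indep3_free V \<longleftrightarrow> (\<forall>a\<in>V. \<forall>b\<in>V. \<forall>c\<in>V.
     a \<noteq> b \<longrightarrow> a \<noteq> c \<longrightarrow> b \<noteq> c \<longrightarrow> E a b \<or> E a c \<or> E b c)"

text \<open>Let a vertex weigh 2 if it is alone in its class and 1 otherwise; then every class
  weighs exactly 2. The number of colors in use is thus determined by the number of
  singletons.\<close>

lemma card_small_fibres:
  fixes g :: "'a \<Rightarrow> nat"
  assumes "finite V" "\<And>v. v \<in> V \<Longrightarrow> card {w \<in> V. g w = g v} \<le> 2"
  shows "card V + card {v \<in> V. \<forall>w\<in>V. g w = g v \<longrightarrow> w = v} = 2 * card (g ` V)"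
proof -
  let ?s = "\<lambda>v. (1::nat) + (if \<forall>w\<in>V. g w = g v \<longrightarrow> w = v then 1 else 0)"
  have "sum ?s {w \<in> V. g w = y} = 2" if y: "y \<in> g ` V" for y
  proof -
    let ?F = "{w \<in> V. g w = y}"
    obtain v where v: "v \<in> V" "g v = y"
      using y by blast
    have "?F \<noteq> {}"
      using v by blast
    then have "card ?F \<noteq> 0"
      using assms(1) by simp
    moreover have "card ?F \<le> 2"
      using assms(2)[OF v(1)] v(2) by simp
    ultimately consider "card ?F = 1" | "card ?F = 2"
      by linarith
    then show ?thesis
    proof cases
      case 1
      then obtain x where x: "?F = {x}"
        by (meson card_1_singletonE)
      have "w \<in> V \<and> g w = y \<longleftrightarrow> w = x" for w
        using arg_cong[OF x, of "\<lambda>A. w \<in> A"] by simp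
      then have "\<forall>w\<in>V. g w = g x \<longrightarrow> w = x"
        by metis
      then show ?thesis
        unfolding x by simp
    next
      case 2
      then obtain x z where xz: "?F = {x, z}" "x \<noteq> z"
        by (meson card_2_iff)
      have "w \<in> V \<and> g w = y \<longleftrightarrow> w = x \<or> w = z" for w
        using arg_cong[OF xz(1), of "\<lambda>A. w \<in> A"] by simp
      then have "\<not> (\<forall>w\<in>V. g w = g x \<longrightarrow> w = x)" "\<not> (\<forall>w\<in>V. g w = g z \<longrightarrow> w = z)"
        using xz(2) by metis+
      then show ?thesis
        unfolding xz(1) using xz(2) by simp
    qed
  qed
  then have "sum ?s V = 2 * card (g ` V)"
    using sum.image_gen[OF assms(1), of ?s g] by simp
  moreover have "sum ?s V = card V + card {v \<in> V. \<forall>w\<in>V. g w = g v \<longrightarrow> w = v}"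
    using assms(1) by (simp only: sum.distrib) (simp add: sum.If_cases Int_def)
  ultimately show ?thesis
    by simp
qed

lemma card_fibre_le_2:
  assumes "indep3_free V" "finite V" "col V C c" "v \<in> V"
  shows "card {w \<in> V. c w = c v} \<le> 2"
proof (rule ccontr)
  assume "\<not> ?thesis"
  then obtain T where T: "T \<subseteq> {w \<in> V. c w = c v}" "card T = 3"
    using obtain_subset_with_card_n[of 3 "{w \<in> V. c w = c v}"] by auto
  then obtain x y z where "T = {x, y, z}" "x \<noteq> y" "y \<noteq> z" "x \<noteq> z"
    by (auto simp: card_3_iff)
  then have "x \<in> V" "y \<in> V" "z \<in> V" "c x = c v" "c y = c v" "c z = c v" "x \<noteq> y" "y \<noteq> z" "x \<noteq> z"
    using T(1) by auto
  then show False
    using assms(1) col_neq[OF assms(3)] unfolding indep3_free_def by metis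
qed

text \<open>
  Take a reachable coloring sharing as many two-vertex classes with \<open>\<alpha>\<close> as possible. If its singleton
  class \<open>{v}\<close> were contained in a class \<open>{u, v}\<close> of \<open>\<alpha>\<close>, then recoloring \<open>u\<close> would gain a common
  class. So its singletons are singletons of \<open>\<alpha>\<close>, and counting shows that it uses at most as many
  colors as \<open>\<alpha>\<close>.
\<close>

lemma reach_missing_color:
  assumes "indep3_free V" "finite V" "finite C" "col V D \<alpha>" "finite D" "card D < card C" "col V C c"
  shows "\<exists>d. reach V C c d \<and> (\<exists>i\<in>C. \<forall>v\<in>V. d v \<noteq> i)"
proof (rule ccontr)
  assume neg: "\<not> ?thesis"
  define common where "common d = {v \<in> V. \<exists>w\<in>V. w \<noteq> v \<and> d w = d v \<and> \<alpha> w = \<alpha> v}"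
    for d :: "'a \<Rightarrow> nat"
  have "reach V C c c \<and> card (common c) \<le> card V"
    using assms(2) by (auto simp: common_def intro: card_mono)
  moreover have "\<forall>d. reach V C c d \<longrightarrow> card (common d) < Suc (card V)"
    using assms(2) by (auto simp: common_def less_Suc_eq_le intro: card_mono)
  ultimately obtain d where d: "reach V C c d"
    and max: "\<And>e. reach V C c e \<Longrightarrow> card (common e) \<le> card (common d)"
    using ex_has_greatest_nat[of "reach V C c" c "\<lambda>d. card (common d)" "Suc (card V)"] by (auto simp: less_Suc_eq_le)
  have col_d: "col V C d"
    using reach_col[OF d assms(7)] .
  have "\<exists>v\<in>V. d v = i" if "i \<in> C" for i
    using neg d that by metis
  then have "C \<subseteq> d ` V"
    by (auto simp: image_iff)
  then have img: "d ` V = C"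
    using col_d by (auto simp: col_def)
  have "\<forall>w\<in>V. \<alpha> w = \<alpha> v \<longrightarrow> w = v" if v: "v \<in> V" "\<forall>w\<in>V. d w = d v \<longrightarrow> w = v" for v
  proof (rule ccontr)
    assume "\<not> ?thesis"
    then obtain u where u: "u \<in> V" "\<alpha> u = \<alpha> v" "u \<noteq> v"
      by blast
    have uv: "\<not> E u v" "\<not> E v u"
      using u v(1) col_neq[OF assms(4)] by metis+
    define e where "e = d(u := d v)"
    have col_e: "col V C e"
    proof (rule colI)
      show "e w \<in> C" if "w \<in> V" for w
        using colD[OF col_d] that v(1) by (auto simp: e_def)
      show "e w \<noteq> e w'" if "w \<in> V" "w' \<in> V" "E w w'" for w w'
        using col_neq[OF col_d that] v(2) that uv by (auto simp: e_def)
    qed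
    have "step V C d e"
      using col_d col_e by (intro stepI[of _ _ _ _ u]) (auto simp: e_def)
    then have reach: "reach V C c e"
      using d by (meson rtranclp.rtrancl_into_rtrancl)
    \<comment> \<open>A partner \<open>w\<close> of \<open>u\<close> would differ from
      \<open>v\<close>, whose class under \<open>d\<close> is a singleton; then \<open>u\<close>,
      \<open>v\<close>, \<open>w\<close> would be an independent triple inside one class of
      \<open>\<alpha>\<close>. Hence recoloring \<open>u\<close> destroys no common pair.\<close>
    have "u \<notin> common d"
    proof
      assume "u \<in> common d"
      then obtain w where w: "w \<in> V" "w \<noteq> u" "d w = d u" "\<alpha> w = \<alpha> u"
        by (auto simp: common_def)
      then have "w \<noteq> v"
        using v u by metis
      then show False
        using assms(1) u v(1) w col_neq[OF assms(4)] unfolding indep3_free_def by metis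
    qed
    moreover have "common d \<subseteq> common e"
    proof
      fix w assume w: "w \<in> common d"
      then obtain w' where w': "w' \<in> V" "w' \<noteq> w" "d w' = d w" "\<alpha> w' = \<alpha> w"
        by (auto simp: common_def)
      then have "w' \<in> common d"
        using w by (auto simp: common_def intro!: bexI[of _ w])
      then have "w' \<noteq> u" "w \<noteq> u"
        using w \<open>u \<notin> common d\<close> by auto
      then show "w \<in> common e"
        using w w' by (auto simp: common_def e_def)
    qed
    moreover have "u \<in> common e"
      using u v(1) by (auto simp: common_def e_def intro!: bexI[of _ v])
    moreover have "finite (common e)"
      using assms(2) by (simp add: common_def)
    ultimately have "card (common d) < card (common e)"
      by (intro psubset_card_mono) auto
    with max[OF reach] show False
      by simp
  qed
  then have "card {v \<in> V. \<forall>w\<in>V. d w = d v \<longrightarrow> w = v} \<le> card {v \<in> V. \<forall>w\<in>V. \<alpha> w = \<alpha> v \<longrightarrow> w = v}"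
    using assms(2) by (intro card_mono) auto
  moreover have "card V + card {v \<in> V. \<forall>w\<in>V. d w = d v \<longrightarrow> w = v} = 2 * card C"
    using card_small_fibres[OF assms(2) card_fibre_le_2[OF assms(1,2) col_d]] img by simp
  moreover have "card V + card {v \<in> V. \<forall>w\<in>V. \<alpha> w = \<alpha> v \<longrightarrow> w = v} = 2 * card (\<alpha> ` V)"
    using card_small_fibres[OF assms(2) card_fibre_le_2[OF assms(1,2,4)]] .
  moreover have "card (\<alpha> ` V) \<le> card D"
    using assms(4,5) by (intro card_mono) (auto simp: col_def)
  ultimately show False
    using assms(6) by simp
qed

lemma inj_col_card:
  assumes "col V D c" "finite D" "inj_on c V"
  shows "card V \<le> card D"
  using assms by (metis card_inj_on_le col_def)

text \<open>The set peeled off is a two-element class \<open>{u, v}\<close> of a coloring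
  \<open>\<alpha>\<close> that leaves a color spare. Every coloring reaches one that misses some
  color \<open>i\<close>, and giving \<open>i\<close> to \<open>u\<close> and \<open>v\<close> makes
  them a class.\<close>

lemma indep3_free_conn:
  assumes "finite V" "finite C" "indep3_free V" "excess V C"
  shows "conn V C"
  using assms
proof (induction rule: reduction_induct)
  case (hereditary V W)
  then show ?case
    unfolding indep3_free_def by blast
next
  case (step V C)
  obtain D \<alpha> where \<alpha>: "col V D \<alpha>" "finite D" "card D < card C"
    using step(5,2) by (rule excess_card)
  obtain u0 where "u0 \<in> V"
    using step(3) by blast
  \<comment> \<open>If \<open>\<alpha>\<close> were injective, then |V| \<le> |D| < |C| \<le>
    deg(u0) + 1 \<le> |V|. So some class has two vertices.\<close>
  have "card (nbrs V u0) < card V"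
    using card_mono[OF _ nbrs_subset[of V u0]] step(1) \<open>u0 \<in> V\<close>
    by (metis card_Diff1_less finite_Diff le_less_trans)
  then have "\<not> inj_on \<alpha> V"
    using inj_col_card[OF \<alpha>(1,2)] step(7)[OF \<open>u0 \<in> V\<close>] \<alpha>(3) by linarith
  then obtain u v where uv: "u \<in> V" "v \<in> V" "u \<noteq> v" "\<alpha> u = \<alpha> v"
    by (auto simp: inj_on_def)
  have nE: "\<not> E u v" "\<not> E v u"
    using uv col_neq[OF \<alpha>(1)] by metis+
  have third: "w = u \<or> w = v" if "col V C' c" "c u = c v" "w \<in> V" "c w = c u" for C' c w
    using step(4) that uv col_neq[OF that(1)] unfolding indep3_free_def by metis
  let ?S = "{u, v}"
  have exc: "excess (V - ?S) (C - {i})" if "i \<in> C" for i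
    using uv third[OF \<alpha>(1)] colD[OF \<alpha>(1)] \<alpha> step(2) that
    by (intro excess_peel[of V D \<alpha> ?S "\<alpha> u" C]) auto
  have "\<exists>d. reach V C c d \<and> (\<exists>i\<in>C. \<forall>w\<in>V. d w = i \<longleftrightarrow> w \<in> ?S)" if c: "col V C c" for c
  proof -
    obtain d i where d: "reach V C c d" "i \<in> C" "\<forall>v\<in>V. d v \<noteq> i"
      using reach_missing_color[OF step(4,1,2) \<alpha> c] by blast
    have col_d: "col V C d"
      using reach_col[OF d(1) c] .
    let ?e = "\<lambda>w. if w \<in> ?S then i else d w"
    have "col V C ?e"
      using d nE col_d by (intro colI) (auto simp: col_def)
    then have "reach V C d ?e"
      using recolor_set[of ?S V C d i] col_d by simp
    then have "reach V C c ?e"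
      using d(1) by (meson rtranclp_trans)
    moreover have "\<forall>w\<in>V. ?e w = i \<longleftrightarrow> w \<in> ?S"
      using d(3) by auto
    ultimately show ?thesis
      using d(2) by (intro exI[of _ ?e] conjI bexI[of _ i])
  qed
  moreover have "conn (V - ?S) (C - {i})" if "i \<in> C" for i
    using step(2) step(8)[of "V - ?S" "C - {i}"] exc[OF that] uv by auto
  ultimately show ?case
    using uv nE exc step(1,2) by (intro conn_peel[of V C ?S]) auto
qed

section \<open>Triangle-free, paw-free and claw-free graphs\<close>

text \<open>Edges with a common end satisfy the conclusion by symmetry, so the condition concerns
  disjoint edges only; \<open>paw_free\<close> treats coinciding vertices in the same way.\<close>

definition no_2K2 :: "'a set \<Rightarrow> bool" where
  "no_2K2 V \<longleftrightarrow> (\<forall>a\<in>V. \<forall>b\<in>V. \<forall>c\<in>V. \<forall>d\<in>V.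
     E a b \<longrightarrow> E c d \<longrightarrow> E a c \<or> E a d \<or> E b c \<or> E b d)"

definition triangle_free :: "'a set \<Rightarrow> bool" where
  "triangle_free V \<longleftrightarrow> (\<forall>a\<in>V. \<forall>b\<in>V. \<forall>c\<in>V. E a b \<longrightarrow> E a c \<longrightarrow> \<not> E b c)"

definition paw_free :: "'a set \<Rightarrow> bool" where
  "paw_free V \<longleftrightarrow> (\<forall>a\<in>V. \<forall>b\<in>V. \<forall>c\<in>V. \<forall>d\<in>V.
     E a b \<longrightarrow> E a c \<longrightarrow> E b c \<longrightarrow> E a d \<longrightarrow> E b d \<or> E c d)"

definition claw_free :: "'a set \<Rightarrow> bool" where
  "claw_free V \<longleftrightarrow> (\<forall>a\<in>V. \<forall>b\<in>V. \<forall>c\<in>V. \<forall>d\<in>V. b \<noteq> c \<longrightarrow> b \<noteq> d \<longrightarrow> c \<noteq> d \<longrightarrow>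
     E a b \<longrightarrow> E a c \<longrightarrow> E a d \<longrightarrow> E b c \<or> E b d \<or> E c d)"

definition clique :: "'a set \<Rightarrow> 'a set \<Rightarrow> bool" where
  "clique V K \<longleftrightarrow> K \<subseteq> V \<and> (\<forall>x\<in>K. \<forall>y\<in>K. x \<noteq> y \<longrightarrow> E x y)"

lemma no_2K2_subset: "no_2K2 V \<Longrightarrow> W \<subseteq> V \<Longrightarrow> no_2K2 W"
  unfolding no_2K2_def by (meson subsetD)

lemma triangle_free_subset: "triangle_free V \<Longrightarrow> W \<subseteq> V \<Longrightarrow> triangle_free W"
  unfolding triangle_free_def by (meson subsetD)

lemma paw_free_subset: "paw_free V \<Longrightarrow> W \<subseteq> V \<Longrightarrow> paw_free W"
  unfolding paw_free_def by (meson subsetD)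

lemma claw_free_subset: "claw_free V \<Longrightarrow> W \<subseteq> V \<Longrightarrow> claw_free W"
  unfolding claw_free_def by (meson subsetD)

lemma no_2K2D:
  "no_2K2 V \<Longrightarrow> E a b \<Longrightarrow> E c d \<Longrightarrow> a \<in> V \<Longrightarrow> b \<in> V \<Longrightarrow> c \<in> V \<Longrightarrow> d \<in> V \<Longrightarrow>
    \<not> E a c \<Longrightarrow> \<not> E a d \<Longrightarrow> \<not> E b c \<Longrightarrow> E b d"
  unfolding no_2K2_def by blast

lemma triangle_freeD:
  "triangle_free V \<Longrightarrow> E a b \<Longrightarrow> E a c \<Longrightarrow> a \<in> V \<Longrightarrow> b \<in> V \<Longrightarrow> c \<in> V \<Longrightarrow> \<not> E b c"
  unfolding triangle_free_def by blast

lemma paw_freeD: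
  "paw_free V \<Longrightarrow> E a b \<Longrightarrow> E a c \<Longrightarrow> E b c \<Longrightarrow> E a d \<Longrightarrow> a \<in> V \<Longrightarrow> b \<in> V \<Longrightarrow> c \<in> V \<Longrightarrow> d \<in> V \<Longrightarrow>
    \<not> E b d \<Longrightarrow> E c d"
  unfolding paw_free_def by blast

section \<open>Cliques and the degree bound\<close>

lemma clique_insert:
  assumes "clique V K" "v \<in> V" "\<And>a. a \<in> K \<Longrightarrow> E v a"
  shows "clique V (insert v K)"
  using assms E_sym unfolding clique_def by (simp add: ball_conj_distrib)

lemma ex_max_card:
  assumes "finite V" "Q K0" "\<And>K. Q K \<Longrightarrow> K \<subseteq> V"
  obtains K where "Q K" "card K0 \<le> card K" "\<And>K'. Q K' \<Longrightarrow> card K' \<le> card K"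
proof -
  have "\<forall>K. Q K \<longrightarrow> card K < Suc (card V)"
    using assms(1,3) by (simp add: card_mono less_Suc_eq_le)
  then obtain K where "Q K" "\<forall>K'. Q K' \<longrightarrow> card K' \<le> card K"
    using ex_has_greatest_nat[of Q K0 card "Suc (card V)"] assms(2) by auto
  then show thesis
    using that assms(2) by simp
qed

lemma clique_card:
  assumes "clique V K" "col V D c" "finite D"
  shows "card K \<le> card D"
proof (rule inj_col_card)
  show "col K D c"
    using assms(1,2) by (intro col_subset[OF assms(2)]) (simp_all add: clique_def)
  show "inj_on c K"
    using assms(1) col_neq[OF assms(2)] unfolding clique_def inj_on_def by (metis subsetD)
qed fact

text \<open>The clique forces |K| \<le> |D| < |C|, so a vertex of degree below |K| has degree at
  most |C| - 2 and could be deleted. This is how a clique contradicts irreducibility.\<close>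

lemma clique_low_degree:
  assumes "clique V K" "card (nbrs V v) < card K" "excess V C" "finite C"
  shows "\<not> card C \<le> Suc (card (nbrs V v))"
proof -
  obtain D \<alpha> where "col V D \<alpha>" "finite D" "card D < card C"
    using assms(3,4) by (rule excess_card)
  then show ?thesis
    using clique_card[OF assms(1)] assms(2) by (metis leD le_trans Suc_leI less_le_trans)
qed

section \<open>Triangle-free graphs\<close>

lemma card_ge_3E:
  assumes "3 \<le> card A"
  obtains x y z where "x \<in> A" "y \<in> A" "z \<in> A" "x \<noteq> y" "x \<noteq> z" "y \<noteq> z"
proof -
  obtain T where T: "T \<subseteq> A" "card T = 3"
    using obtain_subset_with_card_n[OF assms] by blast
  then obtain x y z where "T = {x, y, z}" "x \<noteq> y" "y \<noteq> z" "x \<noteq> z"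
    unfolding card_3_iff by blast
  then show thesis
    using that[of x y z] T(1) by simp
qed

text \<open>The neighbors of \<open>v\<close> are independent, and each has a neighbor that another
  one lacks. Such private neighbors \<open>y\<close>, \<open>y'\<close> of \<open>x1\<close>,
  \<open>x2\<close> form an edge not seen by \<open>v\<close>, so \<open>x3\<close> sees one of its
  ends. Comparing \<open>x3\<close> with the matching one of \<open>x1\<close>, \<open>x2\<close>
  gives a second such edge, and the two edges together with those at \<open>v\<close> contain an
  induced 2K2.\<close>

lemma three_nbrs_False:
  assumes K: "no_2K2 V" and T: "triangle_free V"
    and fold: "\<And>u v. \<lbrakk>u \<in> V; v \<in> V; u \<noteq> v; \<not> E u v\<rbrakk> \<Longrightarrow> \<exists>w\<in>V. E u w \<and> \<not> E v w"
    and V: "v \<in> V" "x1 \<in> V" "x2 \<in> V" "x3 \<in> V"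
    and E: "E v x1" "E v x2" "E v x3" and ne: "x1 \<noteq> x2" "x1 \<noteq> x3" "x2 \<noteq> x3"
  shows False
proof -
  have nx: "\<not> E x1 x2" "\<not> E x1 x3" "\<not> E x2 x3" "\<not> E x2 x1" "\<not> E x3 x1" "\<not> E x3 x2"
    using triangle_freeD[OF T, of v] V E by blast+
  \<comment> \<open>The case that \<open>x3\<close> is adjacent to \<open>y\<close>; the other case
    arises by exchanging \<open>x1\<close> with \<open>x2\<close> and \<open>y\<close> with
    \<open>y'\<close>.\<close>
  have main: False if h: "x1 \<in> V" "x2 \<in> V" "E v x1" "E v x2" "x1 \<noteq> x2" "x1 \<noteq> x3" "x2 \<noteq> x3"
    "\<not> E x1 x3" "\<not> E x3 x1" "\<not> E x1 x2"
    and y: "y \<in> V" "y' \<in> V" "E x1 y" "\<not> E x2 y" "E x2 y'" "\<not> E x1 y'" "E y y'" "E x3 y"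
    for x1 x2 y y'
  proof -
    obtain z where z: "z \<in> V" "E x1 z" "\<not> E x3 z"
      using fold[OF h(1) V(4) h(6) h(8)] by blast
    obtain z' where z': "z' \<in> V" "E x3 z'" "\<not> E x1 z'"
      using fold[OF V(4) h(1) h(6)[symmetric] h(9)] by blast
    have nv: "\<not> E v y" "\<not> E v y'" "\<not> E v z" "\<not> E v z'"
      using triangle_freeD[OF T, of x1 v y] triangle_freeD[OF T, of x2 v y']
        triangle_freeD[OF T, of x1 v z] triangle_freeD[OF T, of x3 v z'] V E(3) h(1-4) y(1-3,5) z z' E_sym
      by metis+
    have zz': "E z z'"
      using no_2K2D[OF K, of x1 z x3 z'] h(1,8) z z' V(4) E_sym by metis
    have yz: "\<not> E y z" "\<not> E y z'" "\<not> E x3 y'"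
      using triangle_freeD[OF T, of x1 y z] triangle_freeD[OF T, of x3 y z']
        triangle_freeD[OF T, of y x3 y'] h(1) y z z' V(4) E_sym by metis+
    \<comment> \<open>Otherwise \<open>v x2\<close> and \<open>z z'\<close> would induce a 2K2. The
      two cases end with the induced 2K2 formed by \<open>x1 v\<close> and \<open>y' z'\<close>,
      respectively by \<open>v x3\<close> and \<open>y' z\<close>.\<close>
    consider "E x2 z" | "E x2 z'"
      using no_2K2D[OF K, of v x2 z z'] nv zz' h(2,4) V(1) z z' by metis
    then show False
    proof cases
      case 1
      then have "\<not> E y' z"
        using triangle_freeD[OF T, of x2 y' z] h(2) y z by metis
      then have "E y' z'"
        using no_2K2D[OF K, of y y' z z'] yz zz' y z z' by metis
      then show False
        using no_2K2D[OF K, of x1 v y' z'] h(1,3) y nv V(1) z' E_sym by metis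
    next
      case 2
      then have "\<not> E y' z'"
        using triangle_freeD[OF T, of x2 y' z'] h(2) y z' by metis
      then have "E y' z"
        using no_2K2D[OF K, of y y' z' z] yz zz' y z z' E_sym by metis
      then show False
        using no_2K2D[OF K, of v x3 y' z] y nv V(1,4) E(3) z yz by metis
    qed
  qed
  obtain y where y: "y \<in> V" "E x1 y" "\<not> E x2 y"
    using fold[OF V(2,3) _ nx(1)] ne by blast
  obtain y' where y': "y' \<in> V" "E x2 y'" "\<not> E x1 y'"
    using fold[OF V(3,2) _ nx(4)] ne by blast
  have yy': "E y y'"
    using no_2K2D[OF K, of x1 y x2 y'] y y' V nx E_commute by metis
  have nv: "\<not> E v y" "\<not> E v y'"
    using triangle_freeD[OF T, of x1 v y] triangle_freeD[OF T, of x2 v y'] V E y y' E_sym by metis+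
  consider "E x3 y" | "E x3 y'"
    using no_2K2D[OF K, of v x3 y y'] nv yy' E V y y' by metis
  then show False
    using main[of x1 x2 y y'] main[of x2 x1 y' y] y y' yy' E_sym[OF yy'] V E ne nx
    by cases (metis, metis)
qed

lemma two_colors_eq:
  assumes "finite D" "card D \<le> 2" "a \<in> D" "b \<in> D" "x \<in> D" "a \<noteq> x" "b \<noteq> x"
  shows "a = b"
proof (rule ccontr)
  assume "a \<noteq> b"
  then have "card {a, b, x} = 3"
    using assms by simp
  moreover have "card {a, b, x} \<le> card D"
    using assms by (intro card_mono) simp_all
  ultimately show False
    using assms(2) by simp
qed

text \<open>The private neighbors close a 5-cycle \<open>v\<close>, \<open>x1\<close>,
  \<open>y\<close>, \<open>y'\<close>, \<open>x2\<close>, which has no coloring with two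
  colors.\<close>

lemma two_nbrs_False:
  assumes K: "no_2K2 V" and T: "triangle_free V"
    and fold: "\<And>u v. \<lbrakk>u \<in> V; v \<in> V; u \<noteq> v; \<not> E u v\<rbrakk> \<Longrightarrow> \<exists>w\<in>V. E u w \<and> \<not> E v w"
    and V: "v \<in> V" "x1 \<in> V" "x2 \<in> V"
    and E: "E v x1" "E v x2" and ne: "x1 \<noteq> x2"
    and col: "col V D c" "finite D" "card D \<le> 2"
  shows False
proof -
  have nx: "\<not> E x1 x2" "\<not> E x2 x1"
    using triangle_freeD[OF T, of v] V E by blast+
  obtain y where y: "y \<in> V" "E x1 y" "\<not> E x2 y"
    using fold[OF V(2,3) ne nx(1)] by blast
  obtain y' where y': "y' \<in> V" "E x2 y'" "\<not> E x1 y'"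
    using fold[OF V(3,2) ne[symmetric] nx(2)] by blast
  have yy': "E y y'"
    using no_2K2D[OF K, of x1 y x2 y'] y y' V nx E_commute by metis
  have "c y = c v"
    using two_colors_eq[OF col(2,3), of "c y" "c v" "c x1"] colD[OF col(1)] col_neq[OF col(1)] y V E E_sym
    by metis
  moreover have "c y' = c v"
    using two_colors_eq[OF col(2,3), of "c y'" "c v" "c x2"] colD[OF col(1)] col_neq[OF col(1)] y' V E E_sym
    by metis
  ultimately show False
    using col_neq[OF col(1)] y y' yy' by metis
qed

text \<open>A vertex of an irreducible graph has degree at least |D|. Degree three or more is
  excluded outright, degree two only because it forces |D| \<le> 2: the 5-cycle, in which no vertex
  folds, needs three colors and is disposed of by its low degree.\<close>

lemma triangle_free_conn:
  assumes "finite V" "finite C" "no_2K2 V \<and> triangle_free V" "excess V C"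
  shows "conn V C"
  using assms
proof (induction rule: reduction_induct)
  case (hereditary V W)
  then show ?case
    using no_2K2_subset triangle_free_subset by metis
next
  case (step V C)
  obtain D \<alpha> where \<alpha>: "col V D \<alpha>" "finite D" "card D < card C"
    using step(5,2) by (rule excess_card)
  obtain v where v: "v \<in> V"
    using step(3) by blast
  have deg: "card D \<le> card (nbrs V v)"
    using step(7)[OF v] \<alpha>(3) by simp
  have False
  proof (cases "3 \<le> card (nbrs V v)")
    case True
    then obtain x y z where "x \<in> nbrs V v" "y \<in> nbrs V v" "z \<in> nbrs V v" "x \<noteq> y" "x \<noteq> z" "y \<noteq> z"
      by (rule card_ge_3E)
    then show False
      using three_nbrs_False[of V v x y z] step(4,6) v by (simp add: nbrs_def)
  next
    case False
    then have D2: "card D \<le> 2"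
      using deg by simp
    consider "card (nbrs V v) = 0" | "card (nbrs V v) = 1" | "card (nbrs V v) = 2"
      using False by linarith
    then show False
    proof cases
      case 1
      then show False
        using deg \<alpha>(2) colD[OF \<alpha>(1) v] by simp
    next
      case 2
      then obtain w where "w \<in> V" "E v w"
        by (metis (no_types, lifting) card_1_singletonE insertI1 mem_Collect_eq nbrs_def)
      then have "\<alpha> v \<noteq> \<alpha> w" "\<alpha> w \<in> D"
        using col_neq[OF \<alpha>(1) v] colD[OF \<alpha>(1)] by simp_all
      then have "card {\<alpha> v, \<alpha> w} \<le> card D"
        using \<alpha>(2) colD[OF \<alpha>(1) v] by (intro card_mono) simp_all
      then show False
        using deg 2 \<open>\<alpha> v \<noteq> \<alpha> w\<close> by simp
    next
      case 3
      then obtain x y where "nbrs V v = {x, y}" "x \<noteq> y"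
        unfolding card_2_iff by blast
      then have "x \<in> nbrs V v" "y \<in> nbrs V v" "x \<noteq> y"
        by simp_all
      then show False
        using two_nbrs_False[of V v x y D \<alpha>] step(4,6) v \<alpha> D2 by (simp add: nbrs_def)
    qed
  qed
  then show ?case ..
qed

text \<open>In an irreducible graph a maximum clique \<open>K\<close> with at least three vertices
  has no neighbor outside, so its vertices have degree below |K|.\<close>

lemma paw_free_conn:
  assumes "finite V" "finite C" "no_2K2 V \<and> paw_free V" "excess V C"
  shows "conn V C"
  using assms
proof (induction rule: reduction_induct)
  case (hereditary V W)
  then show ?case
    using no_2K2_subset paw_free_subset by metis
next
  case (step V C)
  have K2: "no_2K2 V" and paw: "paw_free V"
    using step(4) by simp_all
  show ?case
  proof (cases "triangle_free V")
    case True
    then show ?thesis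
      using triangle_free_conn step(1,2,4,5) by simp
  next
    case False
    then obtain a b c where abc: "a \<in> V" "b \<in> V" "c \<in> V" "E a b" "E a c" "E b c"
      unfolding triangle_free_def by blast
    then have "a \<noteq> b" "a \<noteq> c" "b \<noteq> c"
      by (metis E_irrefl)+
    moreover have "clique V {a, b, c}"
      using abc E_sym by (simp add: clique_def)
    moreover have "K \<subseteq> V" if "clique V K" for K
      using that by (simp add: clique_def)
    ultimately obtain K where K: "clique V K" "card {a, b, c} \<le> card K"
      and max: "\<And>K'. clique V K' \<Longrightarrow> card K' \<le> card K"
      using ex_max_card[of V "clique V" "{a, b, c}"] step(1) by metis
    have K3: "3 \<le> card K"
      using K(2) \<open>a \<noteq> b\<close> \<open>a \<noteq> c\<close> \<open>b \<noteq> c\<close> by simp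
    have KV: "K \<subseteq> V" "finite K"
      using K(1) finite_subset[OF _ step(1)] by (simp_all add: clique_def)
    have KE: "E x y" if "x \<in> K" "y \<in> K" "x \<noteq> y" for x y
      using K(1) that by (simp add: clique_def)
    have ext: "\<exists>a\<in>K. \<not> E v a" if "v \<in> V" "v \<notin> K" for v
    proof (rule ccontr)
      assume "\<not> ?thesis"
      then have "clique V (insert v K)"
        using K(1) that by (intro clique_insert) simp_all
      then show False
        using max[of "insert v K"] KV that by simp
    qed
    \<comment> \<open>By paw-freeness such a \<open>v\<close> sees all of \<open>K\<close> except
      one vertex \<open>a\<close>. A neighbor \<open>x\<close> of \<open>a\<close> missed by
      \<open>v\<close> lies outside \<open>K\<close> and would see all of \<open>K\<close>, against
      maximality.\<close>
    have outside: "\<not> E v p" if v: "v \<in> V" "v \<notin> K" and p: "p \<in> K" for v p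
    proof
      assume vp: "E v p"
      obtain a where a: "a \<in> K" "\<not> E v a"
        using ext[OF v] by blast
      have others: "E v b" if "b \<in> K" "b \<noteq> a" for b
      proof (rule ccontr)
        assume "\<not> E v b"
        then show False
          using paw_freeD[OF paw, of p a b v] KE a that p vp v KV E_commute by (metis subsetD)
      qed
      have "a \<noteq> v" "\<not> E a v"
        using a v E_sym by metis+
      then obtain x where x: "x \<in> V" "E a x" "\<not> E v x"
        using step(6)[of a v] a KV v by (metis subsetD)
      have "E x b" if b: "b \<in> K" for b
      proof (cases "b = a")
        case True
        then show ?thesis
          using x E_sym by simp
      next
        case False
        obtain c where c: "c \<in> K" "c \<noteq> a" "c \<noteq> b"
          using K3 by (rule card_ge_3E) metis
        have V: "a \<in> V" "b \<in> V" "c \<in> V"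
          using a b c KV by (simp_all add: subsetD)
        have E1: "E a b" "E a c" "E b c" "E c b"
          using KE a b c False by simp_all
        have E2: "E v b" "E v c" "E b v" "E c v"
          using others b c False E_sym by simp_all
        \<comment> \<open>This is the triangle \<open>a b c\<close> with \<open>x\<close> attached
          to \<open>a\<close>. If it is \<open>c\<close> that sees \<open>x\<close>, the triangle
          \<open>c v b\<close> with \<open>x\<close> attached to \<open>c\<close> shows that
          \<open>b\<close> does too, since \<open>v\<close> misses \<open>x\<close>.\<close>
        have "E b x \<or> E c x"
          using paw_freeD[OF paw E1(1-3) x(2) V x(1)] by blast
        then have "E b x"
          using paw_freeD[OF paw E2(4) E1(4) E2(1) _ V(3) v(1) V(2) x(1) x(3)] by blast
        then show ?thesis
          by (rule E_sym)
      qed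
      then show False
        using ext[OF x(1)] others x E_irrefl by metis
    qed
    obtain v where v: "v \<in> K"
      using K3 by (rule card_ge_3E)
    have "nbrs V v \<subseteq> K - {v}"
    proof
      fix w assume "w \<in> nbrs V v"
      then have "w \<in> V" "E v w" "w \<noteq> v"
        using E_irrefl by (auto simp: nbrs_def)
      then show "w \<in> K - {v}"
        using outside[of w v] v E_sym by blast
    qed
    then have "card (nbrs V v) < card K"
      using card_mono[of "K - {v}" "nbrs V v"] card_Diff1_less[of K v] KV v by simp
    then show ?thesis
      using clique_low_degree[OF K(1) _ step(5,2)] step(7)[of v] v KV by (simp add: subsetD)
  qed
qed

text \<open>If there is an independent triple, the complement of a maximum independent set
  \<open>I\<close> turns out to be a clique. A vertex of \<open>I\<close> misses some vertex of this
  clique, so its degree is below the size of the clique.\<close>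

lemma claw_free_conn:
  assumes "finite V" "finite C" "no_2K2 V \<and> claw_free V" "excess V C"
  shows "conn V C"
  using assms
proof (induction rule: reduction_induct)
  case (hereditary V W)
  then show ?case
    using no_2K2_subset claw_free_subset by metis
next
  case (step V C)
  have K2: "no_2K2 V" and claw: "claw_free V"
    using step(4) by simp_all
  have clawD: False if "u \<in> V" "x \<in> V" "y \<in> V" "z \<in> V" "x \<noteq> y" "x \<noteq> z" "y \<noteq> z"
    "E u x" "E u y" "E u z" "\<not> E x y" "\<not> E x z" "\<not> E y z" for u x y z
    using claw that unfolding claw_free_def by blast
  show ?case
  proof (cases "indep3_free V")
    case True
    then show ?thesis
      using indep3_free_conn step(1,2,5) by simp
  next
    case False
    define indep where "indep I \<longleftrightarrow> I \<subseteq> V \<and> (\<forall>x\<in>I. \<forall>y\<in>I. \<not> E x y)" for I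
    obtain a b c where abc: "a \<in> V" "b \<in> V" "c \<in> V" "a \<noteq> b" "a \<noteq> c" "b \<noteq> c"
        "\<not> E a b" "\<not> E a c" "\<not> E b c"
      using False unfolding indep3_free_def by blast
    then have "indep {a, b, c}"
      using E_commute by (simp add: indep_def)
    moreover have "I \<subseteq> V" if "indep I" for I
      using that by (simp add: indep_def)
    ultimately obtain I where I: "indep I" "card {a, b, c} \<le> card I"
      and max: "\<And>I'. indep I' \<Longrightarrow> card I' \<le> card I"
      using ex_max_card[of V indep "{a, b, c}"] step(1) by metis
    have I3: "3 \<le> card I"
      using I(2) abc(4-6) by simp
    have IV: "I \<subseteq> V" "finite I"
      using I(1) finite_subset[OF _ step(1)] by (simp_all add: indep_def)
    have IE: "\<not> E x y" if "x \<in> I" "y \<in> I" for x y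
      using I(1) that by (simp add: indep_def)
    have nbr: "\<exists>p\<in>I. E x p" if "x \<in> V" "x \<notin> I" for x
    proof (rule ccontr)
      assume "\<not> ?thesis"
      then have "indep (insert x I)"
        using I(1) that E_commute by (simp add: indep_def)
      then show False
        using max[of "insert x I"] IV that by simp
    qed
    obtain p1 p2 p3 where p: "p1 \<in> I" "p2 \<in> I" "p3 \<in> I" "p1 \<noteq> p2" "p1 \<noteq> p3" "p2 \<noteq> p3"
      using I3 by (rule card_ge_3E)
    have non_nbr: "\<exists>q\<in>I. \<not> E x q" if "x \<in> V" for x
      using clawD[of x p1 p2 p3] p IE IV that by (metis subsetD)
    \<comment> \<open>Nested neighborhoods in \<open>I\<close>: take a common neighbor
      \<open>p\<close>, a common nonneighbor \<open>q\<close> and a neighbor \<open>z\<close> of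
      \<open>q\<close> missed by \<open>p\<close>. By 2K2-freeness \<open>z\<close> sees
      \<open>x\<close> and \<open>y\<close>, which makes a claw centered at \<open>z\<close>.
      Incomparable neighborhoods give an induced 2K2 directly.\<close>
    have sub: False if xy: "x \<in> V" "y \<in> V" "x \<notin> I" "y \<notin> I" "x \<noteq> y" "\<not> E x y"
      and le: "\<And>p. p \<in> I \<Longrightarrow> E x p \<Longrightarrow> E y p" for x y
    proof -
      obtain p where p: "p \<in> I" "E x p" "E y p"
        using nbr[of x] xy le by metis
      obtain q where q: "q \<in> I" "\<not> E y q" "\<not> E x q"
        using non_nbr[of y] xy le by metis
      have V: "p \<in> V" "q \<in> V"
        using p q IV by (simp_all add: subsetD)
      obtain z where z: "z \<in> V" "E q z" "\<not> E p z"
        using step(6)[of q p] V IE[OF q(1) p(1)] p q by metis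
      have "E z x" "E z y"
        using no_2K2D[OF K2, of p x q z] no_2K2D[OF K2, of p y q z] IE p q z xy V E_commute by metis+
      then show False
        using clawD[of z q x y] z q xy V E_commute by metis
    qed
    have "E x y" if xy: "x \<in> V - I" "y \<in> V - I" "x \<noteq> y" for x y
    proof (rule ccontr)
      assume nE: "\<not> E x y"
      then have "\<not> E y x"
        using E_sym by blast
      then obtain p q where "p \<in> I" "E x p" "\<not> E y p" "q \<in> I" "E y q" "\<not> E x q"
        using sub[of x y] sub[of y x] nE xy by blast
      then show False
        using no_2K2D[OF K2, of x p y q] xy IV IE nE E_commute by (metis DiffE subsetD)
    qed
    then have cl: "clique V (V - I)"
      by (simp add: clique_def)
    obtain z where z: "z \<in> V" "E p2 z" "\<not> E p1 z"
      using step(6)[of p2 p1] p IE IV by (metis subsetD)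
    have "nbrs V p1 \<subset> V - I"
    proof
      show "nbrs V p1 \<subseteq> V - I"
        using IE p(1) by (auto simp: nbrs_def)
      have "z \<in> V - I" "z \<notin> nbrs V p1"
        using z IE p(2) by (auto simp: nbrs_def)
      then show "nbrs V p1 \<noteq> V - I"
        by blast
    qed
    then have "card (nbrs V p1) < card (V - I)"
      using step(1) by (simp add: psubset_card_mono)
    then show ?thesis
      using clique_low_degree[OF cl _ step(5,2)] step(7)[of p1] p IV by (simp add: subsetD)
  qed
qed

section \<open>Diamond-free graphs\<close>

definition diamond_free :: "'a set \<Rightarrow> bool" where
  "diamond_free V \<longleftrightarrow> (\<forall>a\<in>V. \<forall>b\<in>V. \<forall>c\<in>V. \<forall>d\<in>V.
     E a b \<longrightarrow> E a c \<longrightarrow> E b c \<longrightarrow> E a d \<longrightarrow> E b d \<longrightarrow> c \<noteq> d \<longrightarrow> E c d)"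

lemma diamond_free_subset: "diamond_free V \<Longrightarrow> W \<subseteq> V \<Longrightarrow> diamond_free W"
  unfolding diamond_free_def by (meson subsetD)

lemma diamond_freeD:
  "diamond_free V \<Longrightarrow> E a b \<Longrightarrow> E a c \<Longrightarrow> E b c \<Longrightarrow> E a d \<Longrightarrow> E b d \<Longrightarrow>
    a \<in> V \<Longrightarrow> b \<in> V \<Longrightarrow> c \<in> V \<Longrightarrow> d \<in> V \<Longrightarrow> c \<noteq> d \<Longrightarrow> E c d"
  unfolding diamond_free_def by blast

text \<open>
  The circular clique \<open>K\<^bsub>9/3\<^esub>\<close>, indexed periodically by the integers so that its rotations are
  shifts of the index. It is the only irreducible graph of the diamond-free case with an
  independent triple.
\<close>

definition K93 :: "(int \<Rightarrow> 'a) \<Rightarrow> 'a set \<Rightarrow> bool" where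
  "K93 g V \<longleftrightarrow> V = range g \<and> (\<forall>i j. (E (g i) (g j) \<longleftrightarrow> (i - j) mod 9 \<in> {3, 4, 5, 6}) \<and>
     (g i = g j \<longleftrightarrow> (i - j) mod 9 = 0))"

lemma K93_shift: "K93 g V \<Longrightarrow> K93 (\<lambda>i. g (i + s)) V"
  unfolding K93_def
proof (elim conjE, intro conjI)
  assume V: "V = range g"
  have "g i \<in> range (\<lambda>i. g (i + s))" for i
    using rangeI[of "\<lambda>i. g (i + s)" "i - s"] by simp
  then show "V = range (\<lambda>i. g (i + s))"
    unfolding V by blast
qed simp

lemma K93_E: "K93 g V \<Longrightarrow> E (g i) (g j) \<longleftrightarrow> (i - j) mod 9 \<in> {3, 4, 5, 6}"
  by (simp add: K93_def)

lemma K93_eq: "K93 g V \<Longrightarrow> g i = g j \<longleftrightarrow> (i - j) mod 9 = 0"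
  by (simp add: K93_def)

lemma int_mod_9: "i mod 9 \<in> {0, 1, 2, 3, 4, 5, 6, 7, 8}" for i :: int
proof -
  have "0 \<le> i mod 9" "i mod 9 < 9"
    by simp_all
  then show ?thesis
    unfolding insert_iff empty_iff by linarith
qed

lemma K93_verts:
  assumes "K93 g V"
  shows "V = {g 0, g 1, g 2, g 3, g 4, g 5, g 6, g 7, g 8}"
proof -
  have "g i \<in> {g 0, g 1, g 2, g 3, g 4, g 5, g 6, g 7, g 8}" for i
  proof -
    have "i mod 9 \<in> {0, 1, 2, 3, 4, 5, 6, 7, 8}"
      by (rule int_mod_9)
    moreover have "g i = g (i mod 9)"
      using K93_eq[OF assms] by simp
    ultimately show ?thesis
      by auto
  qed
  moreover have "V = range g"
    using assms by (simp add: K93_def)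
  ultimately show ?thesis
    by auto
qed

lemma K93_card:
  assumes "K93 g V"
  shows "card V = 9"
  unfolding K93_verts[OF assms] by (simp add: K93_eq[OF assms])

lemma odd_fibre:
  fixes c :: "'a \<Rightarrow> nat"
  assumes "finite V" "odd (card V)"
  obtains v where "v \<in> V" "odd (card {w \<in> V. c w = c v})"
proof -
  have "card V = (\<Sum>y\<in>c ` V. card {w \<in> V. c w = y})"
    using sum.image_gen[OF assms(1), of "\<lambda>_. 1::nat" c] by simp
  then obtain y where "y \<in> c ` V" "odd (card {w \<in> V. c w = y})"
    using assms(2) dvd_sum[of "c ` V" 2 "\<lambda>y. card {w \<in> V. c w = y}"] by metis
  then show thesis
    using that by blast
qed

text \<open>
  The color classes have at most three vertices and there are nine vertices, so some class has odd
  size. It is a full set of three consecutive vertices, or a singleton, which absorbs both of its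
  cyclic neighbors.
\<close>

lemma K93_reach_class:
  assumes g: "K93 g V" and c: "col V C c"
  shows "\<exists>d s m. reach V C c d \<and> m \<in> C \<and> (\<forall>w\<in>V. d w = m \<longleftrightarrow> w \<in> {g s, g (s + 1), g (s + 2)})"
proof -
  have fin: "finite V"
    using K93_verts[OF g] by simp
  have "odd (card V)"
    using K93_card[OF g] by simp
  then obtain v where v: "v \<in> V" "odd (card {w \<in> V. c w = c v})"
    using odd_fibre[OF fin, of c] by blast
  obtain j where j: "v = g j"
    using v(1) g by (auto simp: K93_def)
  define h where "h i = g (i + j)" for i
  have h: "K93 h V"
    using K93_shift[OF g, of j] unfolding h_def .
  define m where "m = c v"
  have c0: "c (h 0) = m"
    by (simp add: h_def m_def j)
  have V: "V = {h 0, h 1, h 2, h 3, h 4, h 5, h 6, h 7, h 8}"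
    by (rule K93_verts[OF h])
  have inV: "h i \<in> V" for i
    using h unfolding K93_def by blast
  have odd: "odd (card {w \<in> V. c w = m})"
    using v(2) by (simp add: m_def)
  have adj: "c (h i) \<noteq> c (h k)" if "(i - k) mod 9 \<in> {3, 4, 5, 6}" for i k
    using col_neq[OF c inV inV] K93_E[OF h] that by metis
  have far: "c (h 3) \<noteq> m" "c (h 4) \<noteq> m" "c (h 5) \<noteq> m" "c (h 6) \<noteq> m"
    using adj[of 3 0] adj[of 4 0] adj[of 5 0] adj[of 6 0] c0 by simp_all
  have excl: "\<not> (c (h 1) = m \<and> c (h 7) = m)" "\<not> (c (h 2) = m \<and> c (h 7) = m)" "\<not> (c (h 2) = m \<and> c (h 8) = m)"
    using adj[of 7 1] adj[of 7 2] adj[of 8 2] by auto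
  have exactI: ?thesis if "\<forall>w\<in>V. d w = m \<longleftrightarrow> w \<in> {h s, h (s + 1), h (s + 2)}" "reach V C c d" for d s
    using that colD[OF c, of v] v(1) unfolding h_def m_def
    by (intro exI[of _ d] exI[of _ "s + j"] exI[of _ "c v"]) (simp add: algebra_simps)
  have even: False if "{w \<in> V. c w = m} = {h 0, h k}" "k mod 9 \<noteq> 0" for k
    using odd that K93_eq[OF h, of 0 k] by (simp add: mod_minus_cong zmod_zminus1_eq_if)
  note eqs = K93_eq[OF h]
  consider "c (h 7) = m" "c (h 8) = m" | "c (h 7) = m" "c (h 8) \<noteq> m"
    | "c (h 2) = m" "c (h 1) = m" | "c (h 2) = m" "c (h 1) \<noteq> m"
    | "c (h 7) \<noteq> m" "c (h 2) \<noteq> m" "c (h 1) = m" "c (h 8) = m"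
    | "c (h 7) \<noteq> m" "c (h 2) \<noteq> m" "c (h 1) = m" "c (h 8) \<noteq> m"
    | "c (h 7) \<noteq> m" "c (h 2) \<noteq> m" "c (h 1) \<noteq> m" "c (h 8) = m"
    | "c (h 7) \<noteq> m" "c (h 2) \<noteq> m" "c (h 1) \<noteq> m" "c (h 8) \<noteq> m"
    by blast
  then show ?thesis
  proof cases
    case 1
    then have "\<forall>w\<in>V. c w = m \<longleftrightarrow> w \<in> {h 7, h (7 + 1), h (7 + 2)}"
      using far excl c0 unfolding V by (simp add: eqs)
    then show ?thesis
      by (rule exactI) simp
  next
    case 2
    then have "{w \<in> V. c w = m} = {h 0, h 7}"
      using far excl c0 unfolding V by auto
    then have False
      by (rule even) simp
    then show ?thesis ..
  next
    case 3
    then have "\<forall>w\<in>V. c w = m \<longleftrightarrow> w \<in> {h 0, h (0 + 1), h (0 + 2)}"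
      using far excl c0 unfolding V by (simp add: eqs)
    then show ?thesis
      by (rule exactI) simp
  next
    case 4
    then have "{w \<in> V. c w = m} = {h 0, h 2}"
      using far excl c0 unfolding V by auto
    then have False
      by (rule even) simp
    then show ?thesis ..
  next
    case 5
    then have "\<forall>w\<in>V. c w = m \<longleftrightarrow> w \<in> {h 8, h (8 + 1), h (8 + 2)}"
      using far excl c0 unfolding V by (simp add: eqs)
    then show ?thesis
      by (rule exactI) simp
  next
    case 6
    then have "{w \<in> V. c w = m} = {h 0, h 1}"
      using far excl c0 unfolding V by auto
    then have False
      by (rule even) simp
    then show ?thesis ..
  next
    case 7
    then have "{w \<in> V. c w = m} = {h 0, h 8}"
      using far excl c0 unfolding V by auto
    then have False
      by (rule even) simp
    then show ?thesis ..
  next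
    case 8
    let ?d = "\<lambda>w. if w \<in> {h 8, h 1} then m else c w"
    have exact: "\<forall>w\<in>V. ?d w = m \<longleftrightarrow> w \<in> {h 8, h (8 + 1), h (8 + 2)}"
      using 8 far c0 unfolding V by (simp add: eqs)
    have "col V C ?d"
    proof (rule colI)
      show "?d w \<in> C" if "w \<in> V" for w
        using colD[OF c that] colD[OF c v(1)] by (simp add: m_def)
      show "?d w \<noteq> ?d w'" if "w \<in> V" "w' \<in> V" "E w w'" for w w'
      proof
        assume eq: "?d w = ?d w'"
        show False
        proof (cases "?d w = m")
          case True
          then have "w \<in> {h 8, h (8 + 1), h (8 + 2)}" "w' \<in> {h 8, h (8 + 1), h (8 + 2)}"
            using exact that eq by metis+
          then show False
            using that(3) by (auto simp: K93_E[OF h])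
        next
          case False
          then have "?d w = c w" "?d w' = c w'"
            using eq by (metis (full_types))+
          then show False
            using col_neq[OF c that] eq by simp
        qed
      qed
    qed
    then have "reach V C c ?d"
      using recolor_set[of "{h 8, h 1}" V C c m] c by simp
    with exact show ?thesis
      by (rule exactI)
  qed
qed

text \<open>A fourth color lets the class move on by one. The six other vertices are rearranged into
  two classes of three; \<open>g 0\<close>, the only neighbor of \<open>g 3\<close> in the class,
  leaves for the free color \<open>m3\<close>, and \<open>g 3\<close> can take
  \<open>m\<close>.\<close>

lemma K93_next_class:
  assumes g: "K93 g V" and "finite C" "4 \<le> card C" "m \<in> C"
    and d: "col V C d" "\<forall>w\<in>V. d w = m \<longleftrightarrow> w \<in> {g 0, g 1, g 2}"
    and conn: "conn (V - {g 0, g 1, g 2}) (C - {m})"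
  shows "\<exists>e. reach V C d e \<and> (\<forall>w\<in>V. e w = m \<longleftrightarrow> w \<in> {g 1, g 2, g 3})"
proof -
  have "3 \<le> card (C - {m})"
    using assms(2-4) by simp
  then obtain m1 m2 m3 where "m1 \<in> C - {m}" "m2 \<in> C - {m}" "m3 \<in> C - {m}"
    and m: "m1 \<noteq> m2" "m1 \<noteq> m3" "m2 \<noteq> m3"
    by (rule card_ge_3E)
  then have mC: "m1 \<in> C" "m2 \<in> C" "m3 \<in> C" "m1 \<noteq> m" "m2 \<noteq> m" "m3 \<noteq> m"
    by auto
  have V: "V = {g 0, g 1, g 2, g 3, g 4, g 5, g 6, g 7, g 8}"
    by (rule K93_verts[OF g])
  note facts = K93_E[OF g] K93_eq[OF g] mC m mC(4-6)[symmetric] m[symmetric] assms(4)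
  define f where "f = (\<lambda>w. if w \<in> {g 0, g 1, g 2} then m else if w \<in> {g 3, g 4, g 5} then m1 else m2)"
  have f: "col V C f" "\<forall>w\<in>V. f w = m \<longleftrightarrow> w \<in> {g 0, g 1, g 2}"
    unfolding V f_def col_def by (simp_all add: facts)
  have f0: "col V C (f(g 0 := m3))"
    unfolding V f_def col_def by (simp add: facts)
  have f3: "col V C (f(g 0 := m3, g 3 := m))"
    unfolding V f_def col_def by (simp add: facts)
  have "reach V C d f"
    using reach_same_class[OF assms(4) conn d(1) _ f(1)] d(2) f(2) by simp
  moreover have "step V C f (f(g 0 := m3))"
    using f(1) f0 by (rule stepI[where v = "g 0"]) simp
  moreover have "step V C (f(g 0 := m3)) (f(g 0 := m3, g 3 := m))"
    using f0 f3 by (rule stepI[where v = "g 3"]) simp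
  ultimately have "reach V C d (f(g 0 := m3, g 3 := m))"
    by (meson rtranclp.rtrancl_into_rtrancl)
  moreover have "\<forall>w\<in>V. (f(g 0 := m3, g 3 := m)) w = m \<longleftrightarrow> w \<in> {g 1, g 2, g 3}"
    unfolding V f_def by (simp add: facts)
  ultimately show ?thesis
    by blast
qed

lemma K93_excess:
  assumes g: "K93 g V" and "finite C" "3 \<le> card C"
  shows "excess (V - {g 0, g 1, g 2}) C"
proof (rule excessI)
  show "col (V - {g 0, g 1, g 2}) {0, 1} (\<lambda>w. if w \<in> {g 3, g 4, g 5} then 0 else 1)"
    unfolding K93_verts[OF g] col_def by (simp add: K93_E[OF g] K93_eq[OF g] insert_Diff_if)
qed (use assms in auto)

lemma K93_conn:
  assumes g: "K93 g V" and "finite C" "4 \<le> card C"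
    and IH: "\<And>W C'. \<lbrakk>W \<subset> V; finite C'; excess W C'\<rbrakk> \<Longrightarrow> conn W C'"
  shows "conn V C"
proof -
  define S where "S s = {g s, g (s + 1), g (s + 2)}" for s
  have SV: "S s \<subseteq> V" "S s \<noteq> {}" for s
    using g by (auto simp: S_def K93_def)
  have exc: "excess (V - S s) (C - {i})" if "i \<in> C" for s i
    using K93_excess[OF K93_shift[OF g, of s], of "C - {i}"] assms(2,3) that
    by (simp add: S_def add.commute)
  have conn: "conn (V - S s) (C - {i})" if "i \<in> C" for s i
    using IH[OF _ _ exc[OF that]] assms(2) SV[of s] by blast
  have iterate: "\<exists>e. reach V C d e \<and> (\<forall>w\<in>V. e w = m \<longleftrightarrow> w \<in> S (s + int n))"
    if "col V C d" "m \<in> C" "\<forall>w\<in>V. d w = m \<longleftrightarrow> w \<in> S s" for d m s n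
  proof (induction n)
    case 0
    show ?case
      using that(3) by (intro exI[of _ d]) simp
  next
    case (Suc n)
    then obtain e where e: "reach V C d e" "\<forall>w\<in>V. e w = m \<longleftrightarrow> w \<in> S (s + int n)"
      by blast
    let ?t = "s + int n"
    have "\<exists>e'. reach V C e e' \<and> (\<forall>w\<in>V. e' w = m \<longleftrightarrow> w \<in> {g (1 + ?t), g (2 + ?t), g (3 + ?t)})"
      using e(2) conn[OF that(2), of ?t]
      by (intro K93_next_class[OF K93_shift[OF g, of ?t] assms(2,3) that(2) reach_col[OF e(1) that(1)]])
        (simp_all add: S_def add_ac)
    then obtain e' where "reach V C e e'" "\<forall>w\<in>V. e' w = m \<longleftrightarrow> w \<in> S (s + int (Suc n))"
      by (auto simp: S_def add_ac)
    with e(1) show ?case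
      by (meson rtranclp_trans)
  qed
  have "\<exists>d. reach V C c d \<and> (\<exists>i\<in>C. \<forall>w\<in>V. d w = i \<longleftrightarrow> w \<in> S 0)" if c: "col V C c" for c
  proof -
    obtain d s m where d: "reach V C c d" "m \<in> C" "\<forall>w\<in>V. d w = m \<longleftrightarrow> w \<in> S s"
      using K93_reach_class[OF g c] unfolding S_def by blast
    \<comment> \<open>The class is rotated until its start is 0 modulo 9, so that all colorings
      arrive at the same set \<open>S 0\<close>.\<close>
    define n where "n = nat ((- s) mod 9)"
    have n: "(s + int n) mod 9 = 0"
      by (simp add: n_def mod_add_right_eq)
    have "g (s + int n + k) = g k" for k
      using n by (simp add: K93_eq[OF g])
    then have "S (s + int n) = S 0"
      unfolding S_def by (metis add.right_neutral add_0)
    then show ?thesis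
      using iterate[OF reach_col[OF d(1) c] d(2,3), of n] d(1,2) by (metis rtranclp_trans)
  qed
  then show ?thesis
    using exc conn SV(1) assms(2) K93_verts[OF g] by (intro conn_peel[of V C "S 0"]) simp_all
qed

lemma K93_list:
  assumes "\<forall>i\<in>{0, 1, 2, 3, 4, 5, 6, 7, 8::int}. \<forall>j\<in>{0, 1, 2, 3, 4, 5, 6, 7, 8}.
     (E (h i) (h j) \<longleftrightarrow> (i - j) mod 9 \<in> {3, 4, 5, 6}) \<and> (h i = h j \<longleftrightarrow> i = j)"
  shows "K93 (\<lambda>i. h (i mod 9)) (h ` {0, 1, 2, 3, 4, 5, 6, 7, 8})"
proof -
  let ?N = "{0, 1, 2, 3, 4, 5, 6, 7, 8::int}"
  have "x \<in> range (\<lambda>i. i mod 9)" if "x \<in> ?N" for x :: int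
  proof -
    have "x mod 9 = x"
      using that by auto
    then show ?thesis
      by (metis rangeI)
  qed
  then have "range (\<lambda>i. i mod 9) = ?N"
    using int_mod_9 by (intro subset_antisym subsetI) (metis rangeE)+
  then have "h ` ?N = range (\<lambda>i. h (i mod 9))"
    by (metis image_image)
  moreover have "(E (h (i mod 9)) (h (j mod 9)) \<longleftrightarrow> (i - j) mod 9 \<in> {3, 4, 5, 6})
      \<and> (h (i mod 9) = h (j mod 9) \<longleftrightarrow> (i - j) mod 9 = 0)" for i j
  proof -
    have e: "(i mod 9 - j mod 9) mod 9 = (i - j) mod 9" "i mod 9 = j mod 9 \<longleftrightarrow> (i - j) mod 9 = 0"
      by (rule mod_diff_eq) (simp add: mod_eq_dvd_iff dvd_eq_mod_eq_0)
    show ?thesis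
      using bspec[OF bspec[OF assms int_mod_9[of i]] int_mod_9[of j]] unfolding e .
  qed
  ultimately show ?thesis
    unfolding K93_def by blast
qed

end

text \<open>The diamond-free case with clique number three lands here. For a fixed triangle the
  vertices off it split into three types according to their neighbor in it, and the analysis
  concerns the edges between the types.\<close>

locale triangle_dominated = sgraph E for E :: "'a \<Rightarrow> 'a \<Rightarrow> bool" +
  fixes V :: "'a set"
  assumes no2: "no_2K2 V"
    and fold: "\<lbrakk>u \<in> V; v \<in> V; u \<noteq> v; \<not> E u v\<rbrakk> \<Longrightarrow> \<exists>w\<in>V. E u w \<and> \<not> E v w"
    and dominated: "\<lbrakk>E a b; E a c; E b c; a \<in> V; b \<in> V; c \<in> V; y \<in> V; y \<noteq> a; y \<noteq> b; y \<noteq> c\<rbrakk> \<Longrightarrow>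
      E y a \<and> \<not> E y b \<and> \<not> E y c \<or> \<not> E y a \<and> E y b \<and> \<not> E y c \<or> \<not> E y a \<and> \<not> E y b \<and> E y c"
begin

text \<open>An edge between two vertices attached to \<open>a\<close> would form an induced 2K2 with
  \<open>b c\<close>. So each type is independent.\<close>

lemma same_type:
  assumes "E a b" "E a c" "E b c" "a \<in> V" "b \<in> V" "c \<in> V" "x \<in> V" "y \<in> V"
    "E a x" "E a y" "x \<noteq> b" "x \<noteq> c" "y \<noteq> b" "y \<noteq> c"
  shows "\<not> E x y"
proof
  assume "E x y"
  have "\<not> E x b" "\<not> E x c" "\<not> E y b" "\<not> E y c"
    using dominated[OF assms(1-6), of x] dominated[OF assms(1-6), of y] assms E_irrefl E_sym by metis+
  then show False
    using no_2K2D[OF no2 \<open>E x y\<close> assms(3)] assms by metis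
qed

text \<open>The neighborhood of \<open>y\<close> picks exactly one vertex from each triangle
  \<open>g i\<close>, \<open>g (i + 3)\<close>, \<open>g (i + 6)\<close>, and if it contains
  \<open>g j\<close>, it meets every edge whose two ends are nonadjacent to \<open>g j\<close>.
  These two rules clash.\<close>

lemma K93_no_extra_aux:
  assumes g: "K93 g W" and "W \<subseteq> V" and y: "y \<in> V" "y \<notin> W" "E y (g 0)"
  shows False
proof -
  have gV: "g i \<in> V" for i
    using g assms(2) by (auto simp: K93_def)
  have ne: "y \<noteq> g i" for i
    using g y(2) by (auto simp: K93_def)
  note Eg = K93_E[OF g]
  have tri: "E y (g i) \<and> \<not> E y (g (i + 3)) \<and> \<not> E y (g (i + 6)) \<or>
      \<not> E y (g i) \<and> E y (g (i + 3)) \<and> \<not> E y (g (i + 6)) \<or>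
      \<not> E y (g i) \<and> \<not> E y (g (i + 3)) \<and> E y (g (i + 6))" for i
    using gV ne y(1) by (intro dominated) (simp_all add: Eg)
  have two: "E y (g k) \<or> E y (g l)"
    if "E y (g j)" "(k - l) mod 9 \<in> {3, 4, 5, 6}" "(j - k) mod 9 \<notin> {3, 4, 5, 6}" "(j - l) mod 9 \<notin> {3, 4, 5, 6}"
    for j k l
    using no_2K2D[OF no2 that(1), of "g k" "g l"] that(2-4) gV y(1) unfolding Eg[symmetric] by metis
  have t0: "\<not> E y (g 3)" "\<not> E y (g 6)"
    using tri[of 0] y(3) by simp_all
  have n: "\<not> E y (g 5)" "\<not> E y (g 4)"
    using two[of 5 3 6] two[of 4 3 6] t0 by auto
  consider "E y (g 2)" | "E y (g 8)" "\<not> E y (g 2)"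
    using tri[of 2] n by auto
  then show False
  proof cases
    case 1
    then have "E y (g 1)"
      using two[of 2 4 1] n by auto
    then have "E y (g 8)"
      using two[of 1 3 8] t0 by auto
    then show False
      using 1 tri[of 2] by simp
  next
    case 2
    then have "E y (g 7)"
      using two[of 0 2 7] y(3) by auto
    then have "\<not> E y (g 1)"
      using tri[of 1] by simp
    then show False
      using 2 two[of 8 1 6] t0 by auto
  qed
qed

lemma K93_no_extra:
  assumes g: "K93 g W" and "W \<subseteq> V"
  shows "W = V"
proof (rule ccontr)
  assume "W \<noteq> V"
  then obtain y where y: "y \<in> V" "y \<notin> W"
    using assms(2) by blast
  have gV: "g i \<in> V" and gy: "y \<noteq> g i" for i
    using g assms(2) y(2) by (auto simp: K93_def)
  have "E y (g 0) \<or> E y (g 3) \<or> E y (g 6)"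
    using dominated[of "g 0" "g 3" "g 6" y] gV gy y(1) K93_E[OF g] by auto
  then show False
    using K93_no_extra_aux[OF g assms(2) y] K93_no_extra_aux[OF K93_shift[OF g, of 3] assms(2) y]
      K93_no_extra_aux[OF K93_shift[OF g, of 6] assms(2) y] by auto
qed

text \<open>The eight given vertices determine a ninth: a neighbor \<open>w\<close> of
  \<open>p\<close> missed by \<open>x\<close> is forced to attach to \<open>c\<close>, and all other
  adjacencies follow. A copy of K_{9/3} admits no further vertex, so it is all of
  \<open>V\<close>.\<close>

lemma nine_vertices:
  assumes abc: "E a b" "E a c" "E b c" "a \<in> V" "b \<in> V" "c \<in> V"
    and V: "x \<in> V" "u \<in> V" "v \<in> V" "p \<in> V" "q \<in> V"
    and K: "x \<notin> {a, b, c}" "u \<notin> {a, b, c}" "v \<notin> {a, b, c}" "p \<notin> {a, b, c}" "q \<notin> {a, b, c}"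
    and ty: "E a x" "E a p" "E b u" "E b v" "E c q"
    and uv: "u \<noteq> v" "E x u" "E x v" "E p u" "\<not> E p v" "E q v" "\<not> E q u" "E p q"
  shows "\<exists>g. K93 g V"
proof -
  have only_a: "\<not> E y b \<and> \<not> E y c" if "y \<in> V" "E a y" "y \<notin> {a, b, c}" for y
    using dominated[OF abc that(1)] that E_sym[OF that(2)] by auto
  have only_b: "\<not> E y a \<and> \<not> E y c" if "y \<in> V" "E b y" "y \<notin> {a, b, c}" for y
    using dominated[OF abc that(1)] that E_sym[OF that(2)] by auto
  have only_c: "\<not> E y a \<and> \<not> E y b" if "y \<in> V" "E c y" "y \<notin> {a, b, c}" for y
    using dominated[OF abc that(1)] that E_sym[OF that(2)] by auto
  have bac: "E b a" "E b c" "E a c" "b \<in> V" "a \<in> V" "c \<in> V"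
    and cab: "E c a" "E c b" "E a b" "c \<in> V" "a \<in> V" "b \<in> V"
    using abc E_sym by simp_all
  have nxp: "\<not> E x p" and nuv: "\<not> E u v"
    using same_type[OF abc, of x p] same_type[OF bac, of u v] V K ty by simp_all
  have "x \<noteq> p"
    using uv by blast
  have xq: "E x q"
    using no_2K2D[OF no2 uv(2), of q c] only_a[of x] only_b[of u] E_sym[OF ty(5)] V K ty uv(7) abc E_commute
    by auto
  obtain w where w: "w \<in> V" "E p w" "\<not> E x w"
    using fold[OF V(4,1) \<open>x \<noteq> p\<close>[symmetric]] nxp E_sym by blast
  have wK: "w \<notin> {a, b, c}"
    using w ty(1,2) only_a[OF V(4) ty(2) K(4)] E_sym[OF ty(1)] by auto
  have nwa: "\<not> E a w"
    using same_type[OF abc V(4) w(1) ty(2)] K(4) wK w(2) by blast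
  have nwb: "\<not> E b w"
  proof
    assume bw: "E b w"
    then have "\<not> E v w"
      using same_type[OF bac V(3) w(1) ty(4)] K(3) wK by blast
    then show False
      using no_2K2D[OF no2 uv(3) w(2)] V w nxp uv(5) E_sym by blast
  qed
  have cw: "E c w"
    using dominated[OF abc w(1)] wK nwa nwb E_sym by blast
  have uw: "E u w" and vw: "E v w"
    using no_2K2D[OF no2 uv(2) E_sym[OF cw]] no_2K2D[OF no2 uv(3) E_sym[OF cw]] only_a[OF V(1) ty(1) K(1)]
      only_b[OF V(2) ty(3) K(2)] only_b[OF V(3) ty(4) K(3)] V w abc by blast+
  have "w \<noteq> q"
    using w xq by blast
  have nqw: "\<not> E q w"
    using same_type[OF cab V(5) w(1) ty(5) cw] K(5) wK by blast
  \<comment> \<open>In this cyclic order, between two vertices of the triangle stand the two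
    vertices attached to the third one.\<close>
  define h where "h i = [a, u, v, c, p, x, b, w, q] ! nat i" for i
  have wt: "\<not> E w a" "\<not> E w b"
    using nwa nwb E_sym by blast+
  note pos = abc(1-3) ty uv(2-4,6,8) xq w(2) cw uw vw
  note neg = only_a[OF V(1) ty(1) K(1), THEN conjunct1] only_a[OF V(1) ty(1) K(1), THEN conjunct2]
    only_a[OF V(4) ty(2) K(4), THEN conjunct1] only_a[OF V(4) ty(2) K(4), THEN conjunct2]
    only_b[OF V(2) ty(3) K(2), THEN conjunct1] only_b[OF V(2) ty(3) K(2), THEN conjunct2]
    only_b[OF V(3) ty(4) K(3), THEN conjunct1] only_b[OF V(3) ty(4) K(3), THEN conjunct2]
    only_c[OF V(5) ty(5) K(5), THEN conjunct1] only_c[OF V(5) ty(5) K(5), THEN conjunct2]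
    wt nxp nuv nqw uv(5,7) w(3)
  have nE_sym: "\<not> E z y" if "\<not> E y z" for y z
    using that E_sym by blast
  have dist: "distinct [a, u, v, c, p, x, b, w, q]"
  proof -
    have "a \<noteq> b" "a \<noteq> c" "b \<noteq> c" "u \<noteq> p" "u \<noteq> x" "u \<noteq> w" "u \<noteq> q" "v \<noteq> p" "v \<noteq> x" "v \<noteq> w" "v \<noteq> q"
      "p \<noteq> w" "p \<noteq> q" "x \<noteq> q"
      using pos neg by (metis E_irrefl)+
    moreover have "x \<noteq> w"
      using w(2) nxp E_sym by blast
    ultimately show ?thesis
      using K wK uv(1) \<open>w \<noteq> q\<close> \<open>x \<noteq> p\<close> by auto
  qed
  have "K93 (\<lambda>i. h (i mod 9)) (h ` {0, 1, 2, 3, 4, 5, 6, 7, 8})"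
    using dist distinct_rev[THEN iffD2, OF dist] unfolding h_def
    by (intro K93_list) (simp add: pos pos[THEN E_sym] neg neg[THEN nE_sym])
  moreover have "h ` {0, 1, 2, 3, 4, 5, 6, 7, 8} \<subseteq> V"
    using V abc w(1) by (simp add: h_def)
  ultimately show ?thesis
    using K93_no_extra by metis
qed

text \<open>Private neighbors \<open>p\<close> of \<open>u\<close> and \<open>q\<close> of
  \<open>v\<close> are adjacent, do not attach to \<open>b\<close>, and do not attach to the same
  vertex. So one attaches to \<open>a\<close> and the other to \<open>c\<close>, which is the
  configuration that generates K_{9/3}.\<close>

lemma K93_of_two_nbrs:
  assumes abc: "E a b" "E a c" "E b c" "a \<in> V" "b \<in> V" "c \<in> V"
    and V: "x \<in> V" "u \<in> V" "v \<in> V"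
    and K: "x \<noteq> b" "x \<noteq> c" "u \<noteq> a" "v \<noteq> a"
    and E: "E a x" "E b u" "E b v" "E x u" "E x v" "u \<noteq> v"
  shows "\<exists>g. K93 g V"
proof -
  have bac: "E b a" "E b c" "E a c" "b \<in> V" "a \<in> V" "c \<in> V"
    and cab: "E c a" "E c b" "E a b" "c \<in> V" "a \<in> V" "b \<in> V"
    using abc E_sym by simp_all
  have "x \<noteq> a"
    using E(1) by auto
  then have nx: "\<not> E x b" "\<not> E x c"
    using dominated[OF abc V(1)] K E_sym[OF E(1)] by auto
  have xK: "x \<notin> {a, b, c}" and uK: "u \<notin> {a, b, c}" and vK: "v \<notin> {a, b, c}"
    using \<open>x \<noteq> a\<close> K nx E(4,5) by auto
  have nuv: "\<not> E u v" "\<not> E v u"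
    using same_type[OF bac V(2,3) E(2,3)] uK vK E_sym by blast+
  obtain p where p: "p \<in> V" "E u p" "\<not> E v p"
    using fold[OF V(2,3) E(6) nuv(1)] by blast
  obtain q where q: "q \<in> V" "E v q" "\<not> E u q"
    using fold[OF V(3,2) E(6)[symmetric] nuv(2)] by blast
  have pq: "E p q"
    using no_2K2D[OF no2 p(2) q(2)] p q V nuv E_sym by blast
  have nu: "\<not> E u a" "\<not> E u c" and nv: "\<not> E v a" "\<not> E v c"
    using dominated[OF abc V(2)] dominated[OF abc V(3)] uK vK E_sym[OF E(2)] E_sym[OF E(3)] by auto
  have pK: "p \<notin> {a, b, c}" and qK: "q \<notin> {a, b, c}"
    using p q nu nv E_sym[OF E(2)] E_sym[OF E(3)] by auto
  have "\<not> E b p" "\<not> E b q"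
    using same_type[OF bac V(2) p(1) E(2)] same_type[OF bac V(3) q(1) E(3)] p q uK vK pK qK by blast+
  then have "\<not> E p b" "\<not> E q b"
    using E_sym by blast+
  moreover have "\<not> (E a p \<and> E a q)" "\<not> (E c p \<and> E c q)"
    using same_type[OF abc p(1) q(1)] same_type[OF cab p(1) q(1)] pq pK qK by blast+
  ultimately consider "E a p" "E c q" | "E a q" "E c p"
    using dominated[OF abc p(1)] dominated[OF abc q(1)] pK qK E_sym by blast
  then show ?thesis
  proof cases
    case 1
    then show ?thesis
      using nine_vertices[OF abc V(1-3) p(1) q(1) xK uK vK pK qK E(1) _ E(2,3) _ E(6,4,5)] p q pq E_sym
      by blast
  next
    case 2
    then show ?thesis
      using nine_vertices[OF abc V(1,3,2) q(1) p(1) xK vK uK qK pK E(1) _ E(3,2) _ E(6)[symmetric] E(5,4)]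
        p q E_sym[OF pq] E_sym by blast
  qed
qed

text \<open>Besides \<open>a\<close>, the vertex \<open>x\<close> has two more neighbors, each
  attached to \<open>b\<close> or \<open>c\<close>. Two attached to \<open>c\<close> would produce
  K_{9/3}, so one is attached to \<open>b\<close>.\<close>

lemma nbr_of_type:
  assumes no_K93: "\<nexists>g. K93 g V" and deg: "3 \<le> card (nbrs V x)"
    and abc: "E a b" "E a c" "E b c" "a \<in> V" "b \<in> V" "c \<in> V"
    and x: "x \<in> V" "E a x" "x \<noteq> b" "x \<noteq> c"
  obtains u where "u \<in> V" "u \<notin> {a, b, c}" "E b u" "E x u"
proof -
  have "x \<noteq> a"
    using x(2) by auto
  then have nx: "\<not> E x b" "\<not> E x c"
    using dominated[OF abc x(1)] x E_sym[OF x(2)] by auto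
  obtain y1 y2 y3 where "y1 \<in> nbrs V x" "y2 \<in> nbrs V x" "y3 \<in> nbrs V x" "y1 \<noteq> y2" "y1 \<noteq> y3" "y2 \<noteq> y3"
    using deg by (rule card_ge_3E)
  then obtain y z where yz: "y \<in> nbrs V x" "z \<in> nbrs V x" "y \<noteq> a" "z \<noteq> a" "y \<noteq> z"
    by metis
  then have yzV: "y \<in> V" "z \<in> V" "E x y" "E x z"
    by (simp_all add: nbrs_def)
  have K: "y \<notin> {a, b, c}" "z \<notin> {a, b, c}"
    using yz yzV nx by auto
  have "\<not> E a y" "\<not> E a z"
    using same_type[OF abc x(1) yzV(1) x(2)] same_type[OF abc x(1) yzV(2) x(2)] yzV K x by blast+
  then have ty: "E b y \<or> E c y" "E b z \<or> E c z"
    using dominated[OF abc yzV(1)] dominated[OF abc yzV(2)] K E_sym by blast+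
  have "\<not> (E c y \<and> E c z)"
    using K93_of_two_nbrs[OF abc(2,1) E_sym[OF abc(3)] abc(4,6,5) x(1) yzV(1,2) x(4,3) yz(3,4) x(2) _ _ yzV(3,4) yz(5)]
      no_K93 by blast
  then show thesis
    using ty that[of y] that[of z] yzV K by blast
qed

text \<open>Without K_{9/3} the edges between two types form a perfect matching. If \<open>p\<close>
  and \<open>q\<close> were nonadjacent, the matching edges at \<open>p\<close> and \<open>q\<close>
  between the types of \<open>a\<close> and \<open>b\<close> would induce a 2K2.\<close>

lemma outside_clique_aux:
  assumes no_K93: "\<nexists>g. K93 g V" and deg: "\<forall>x\<in>V. 3 \<le> card (nbrs V x)"
    and abc: "E a b" "E a c" "E b c" "a \<in> V" "b \<in> V" "c \<in> V"
    and pq: "p \<in> V" "q \<in> V" "p \<notin> {a, b, c}" "q \<notin> {a, b, c}" "p \<noteq> q"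
    and ty: "E a p" "E a q \<or> E b q"
  shows "E p q"
proof (rule ccontr)
  assume npq: "\<not> E p q"
  then have nqp: "\<not> E q p"
    using E_sym by blast
  have bac: "E b a" "E b c" "E a c" "b \<in> V" "a \<in> V" "c \<in> V"
    using abc E_sym by simp_all
  have uniq_b: "u = v" if "x \<in> V" "u \<in> V" "v \<in> V" "x \<notin> {a, b, c}" "u \<notin> {a, b, c}" "v \<notin> {a, b, c}"
    "E a x" "E b u" "E b v" "E x u" "E x v" for x u v
    using K93_of_two_nbrs[OF abc that(1-3)] that no_K93 by blast
  have uniq_a: "u = v" if "x \<in> V" "u \<in> V" "v \<in> V" "x \<notin> {a, b, c}" "u \<notin> {a, b, c}" "v \<notin> {a, b, c}"
    "E b x" "E a u" "E a v" "E x u" "E x v" for x u v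
    using K93_of_two_nbrs[OF bac that(1-3)] that no_K93 by blast
  obtain p' where p': "p' \<in> V" "p' \<notin> {a, b, c}" "E b p'" "E p p'"
    using nbr_of_type[OF no_K93 bspec[OF deg pq(1)] abc pq(1) ty(1)] pq(3) by blast
  have "E a q \<and> \<not> E b q \<or> \<not> E a q \<and> E b q"
    using dominated[OF abc pq(2)] pq(4) ty(2) E_sym by blast
  then show False
  proof (elim disjE conjE)
    assume aq: "E a q"
    obtain q' where q': "q' \<in> V" "q' \<notin> {a, b, c}" "E b q'" "E q q'"
      using nbr_of_type[OF no_K93 bspec[OF deg pq(2)] abc pq(2) aq] pq(4) by blast
    have "p' \<noteq> q'"
      using uniq_a[OF p'(1) pq(1,2) p'(2) pq(3,4) p'(3) ty(1) aq] E_sym p'(4) q'(4) pq(5) by blast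
    then have "\<not> E p q'" "\<not> E q p'" "\<not> E p' q'"
      using uniq_b[OF pq(1) p'(1) q'(1) pq(3) p'(2) q'(2) ty(1) p'(3) q'(3) p'(4)]
        uniq_b[OF pq(2) q'(1) p'(1) pq(4) q'(2) p'(2) aq q'(3) p'(3) q'(4)]
        same_type[OF bac p'(1) q'(1) p'(3) q'(3)] p'(2) q'(2) by blast+
    then show False
      using no_2K2D[OF no2 p'(4) q'(4)] p'(1) q'(1) pq npq E_sym by blast
  next
    assume bq: "E b q"
    obtain q' where q': "q' \<in> V" "q' \<notin> {a, b, c}" "E a q'" "E q q'"
      using nbr_of_type[OF no_K93 bspec[OF deg pq(2)] bac pq(2) bq] pq(4) by blast
    have ne: "p' \<noteq> q" "q' \<noteq> p"
      using p'(4) q'(4) npq nqp by blast+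
    have "\<not> E p q'" "\<not> E q p'" "\<not> E p' q'"
      using same_type[OF abc pq(1) q'(1) ty(1) q'(3)] same_type[OF bac pq(2) p'(1) bq p'(3)]
        uniq_a[OF p'(1) pq(1) q'(1) p'(2) pq(3) q'(2) p'(3) ty(1) q'(3) E_sym[OF p'(4)]]
        pq(3,4) p'(2) q'(2) ne by blast+
    then show False
      using no_2K2D[OF no2 p'(4) q'(4)] p'(1) q'(1) pq npq E_sym by blast
  qed
qed

lemma outside_clique:
  assumes no_K93: "\<nexists>g. K93 g V" and deg: "\<forall>x\<in>V. 3 \<le> card (nbrs V x)"
    and abc: "E a b" "E a c" "E b c" "a \<in> V" "b \<in> V" "c \<in> V"
    and pq: "p \<in> V" "q \<in> V" "p \<notin> {a, b, c}" "q \<notin> {a, b, c}" "p \<noteq> q"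
  shows "E p q"
proof -
  have sym: "E b a" "E c a" "E c b"
    using abc E_sym by simp_all
  note aux = outside_clique_aux[OF no_K93 deg]
  have p: "E a p \<or> E b p \<or> E c p" and q: "E a q \<or> E b q \<or> E c q"
    using dominated[OF abc pq(1)] dominated[OF abc pq(2)] pq(3,4) E_sym by blast+
  have "E p q" if "E a p"
    using aux[OF abc pq that] aux[OF abc(2,1) sym(3) abc(4,6,5) pq(1,2) _ _ pq(5) that] q pq(3,4)
    by blast
  moreover have "E p q" if "E b p"
    using aux[OF sym(1) abc(3,2,5,4,6) pq(1,2) _ _ pq(5) that]
      aux[OF abc(3) sym(1,2) abc(5,6,4) pq(1,2) _ _ pq(5) that] q pq(3,4)
    by blast
  moreover have "E p q" if "E c p"
    using aux[OF sym(2,3) abc(1,6,4,5) pq(1,2) _ _ pq(5) that]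
      aux[OF sym(3,2,1) abc(6,5,4) pq(1,2) _ _ pq(5) that] q pq(3,4)
    by blast
  ultimately show ?thesis
    using p by blast
qed

text \<open>Two cliques cover \<open>V\<close>, the triangle and everything outside it, and among
  three vertices two lie in the same clique.\<close>

lemma indep3_free_if_no_K93:
  assumes no_K93: "\<nexists>g. K93 g V" and deg: "\<forall>x\<in>V. 3 \<le> card (nbrs V x)"
    and abc: "E a b" "E a c" "E b c" "a \<in> V" "b \<in> V" "c \<in> V"
  shows "indep3_free V"
  unfolding indep3_free_def
proof (intro ballI impI)
  fix x y z assume V: "x \<in> V" "y \<in> V" "z \<in> V" and ne: "x \<noteq> y" "x \<noteq> z" "y \<noteq> z"
  have inside: "E s t" if "s \<in> {a, b, c}" "t \<in> {a, b, c}" "s \<noteq> t" for s t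
    using that abc E_sym by auto
  note outside = outside_clique[OF no_K93 deg abc]
  show "E x y \<or> E x z \<or> E y z"
    using inside[of x y] inside[of x z] inside[of y z] outside[of x y] outside[of x z] outside[of y z] V ne
    by blast
qed

end

section \<open>Diamond-free graphs by clique number\<close>

context sgraph begin

lemma diamond_free_clique_nbrs:
  assumes "diamond_free V" and K: "clique V K" and y: "y \<in> V" "y \<notin> K"
    and pq: "p \<in> K" "q \<in> K" "p \<noteq> q" "E y p" "E y q" and r: "r \<in> K"
  shows "E y r"
proof (cases "r = p \<or> r = q")
  case False
  have KV: "k \<in> V" if "k \<in> K" for k
    using K that by (auto simp: clique_def)
  have "E p q" "E p r" "E q r"
    using K False pq r unfolding clique_def by metis+
  then show ?thesis
    using diamond_freeD[OF assms(1), of p q r y] KV[OF pq(1)] KV[OF pq(2)] KV[OF r] pq r y E_sym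
    by metis
qed (use pq in auto)

text \<open>Let \<open>K\<close> be a maximum clique. If |K| \<ge> 4, an outside vertex has at most
  one neighbor in \<open>K\<close>, so an edge outside would leave an edge of \<open>K\<close>
  untouched. Hence outside vertices have degree at most one, which is too small, and in
  \<open>V = K\<close> the degrees are too small as well. If |K| = 3, the analysis around a triangle
  applies.\<close>

lemma diamond_free_conn:
  assumes "finite V" "finite C" "no_2K2 V \<and> diamond_free V" "excess V C"
  shows "conn V C"
  using assms
proof (induction rule: reduction_induct)
  case (hereditary V W)
  then show ?case
    using no_2K2_subset diamond_free_subset by metis
next
  case (step V C)
  have K2: "no_2K2 V" and diamond: "diamond_free V"
    using step(4) by simp_all
  obtain D \<alpha> where \<alpha>: "col V D \<alpha>" "finite D" "card D < card C"
    using step(5,2) by (rule excess_card)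
  show ?case
  proof (cases "triangle_free V")
    case True
    then show ?thesis
      using triangle_free_conn step(1,2,4,5) by simp
  next
    case False
    then obtain a b c where abc: "a \<in> V" "b \<in> V" "c \<in> V" "E a b" "E a c" "E b c"
      unfolding triangle_free_def by blast
    have ne: "a \<noteq> b" "a \<noteq> c" "b \<noteq> c"
      using abc by (metis E_irrefl)+
    have cl: "clique V {a, b, c}"
      using abc E_sym by (simp add: clique_def)
    have cl_sub: "K \<subseteq> V" if "clique V K" for K
      using that by (simp add: clique_def)
    obtain K where K: "clique V K" "card {a, b, c} \<le> card K"
      and max: "\<And>K'. clique V K' \<Longrightarrow> card K' \<le> card K"
      using ex_max_card[of V "clique V" "{a, b, c}", OF step(1) cl cl_sub] by metis
    have KV: "K \<subseteq> V" "finite K"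
      using K(1) finite_subset[OF _ step(1)] by (simp_all add: clique_def)
    have K3: "3 \<le> card K"
      using K(2) ne by simp
    have "card K \<le> card D"
      by (rule clique_card[OF K(1) \<alpha>(1,2)])
    then have deg: "card K \<le> card (nbrs V v)" if "v \<in> V" for v
      using step(7)[OF that] \<alpha>(3) by simp
    show ?thesis
    proof (cases "4 \<le> card K")
      case True
      have one: "card {k \<in> K. E y k} \<le> 1" if y: "y \<in> V" "y \<notin> K" for y
      proof (rule ccontr)
        assume "\<not> ?thesis"
        then obtain p q where pq: "p \<in> K" "q \<in> K" "E y p" "E y q" "p \<noteq> q"
          using KV(2) by (auto simp: card_le_Suc0_iff_eq)
        have "E y r" if "r \<in> K" for r
          using diamond_free_clique_nbrs[OF diamond K(1) y pq(1,2,5,3,4) that] .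
        then have "clique V (insert y K)"
          using clique_insert K(1) y(1) by blast
        then show False
          using max[of "insert y K"] KV y by simp
      qed
      have indep: "\<not> E x y" if xy: "x \<in> V" "y \<in> V" "x \<notin> K" "y \<notin> K" for x y
      proof
        assume "E x y"
        let ?A = "{k \<in> K. E x k}" and ?B = "{k \<in> K. E y k}"
        have "card (?A \<union> ?B) \<le> 2"
          using card_Un_le[of ?A ?B] one[of x] one[of y] xy by linarith
        then have "2 \<le> card (K - (?A \<union> ?B))"
          using True diff_card_le_card_Diff[of "?A \<union> ?B" K] KV(2) by simp
        then obtain p q where "p \<in> K - (?A \<union> ?B)" "q \<in> K - (?A \<union> ?B)" "p \<noteq> q"
          using card_le_Suc0_iff_eq[of "K - (?A \<union> ?B)"] KV(2) by fastforce
        then have "p \<in> K" "q \<in> K" "\<not> E x p" "\<not> E x q" "\<not> E y p" "\<not> E y q" "E p q"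
          using K(1) by (auto simp: clique_def)
        then show False
          using no_2K2D[OF K2 \<open>E x y\<close>, of p q] xy KV by blast
      qed
      have "V \<subseteq> K"
      proof
        fix x assume x: "x \<in> V"
        show "x \<in> K"
        proof (rule ccontr)
          assume "x \<notin> K"
          then have "nbrs V x \<subseteq> {k \<in> K. E x k}"
            using indep x by (auto simp: nbrs_def)
          then have "card (nbrs V x) \<le> 1"
            using card_mono[of "{k \<in> K. E x k}" "nbrs V x"] one[OF x \<open>x \<notin> K\<close>] KV(2) by simp
          then show False
            using deg[OF x] True by simp
        qed
      qed
      moreover obtain v where v: "v \<in> K"
        using K3 by (rule card_ge_3E)
      ultimately have "nbrs V v \<subset> K"
        using nbrs_subset[of V v] by blast
      then have "card (nbrs V v) < card K"
        using KV(2) by (rule psubset_card_mono[rotated])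
      then show ?thesis
        using deg v KV(1) by fastforce
    next
      case False
      have K4: False if "clique V K'" "4 \<le> card K'" for K'
        using max[OF that(1)] that(2) False by simp
      interpret triangle_dominated E V
      proof unfold_locales
        show "no_2K2 V"
          by (rule K2)
        show "\<exists>w\<in>V. E u w \<and> \<not> E v w" if "u \<in> V" "v \<in> V" "u \<noteq> v" "\<not> E u v" for u v
          by (rule step(6)[OF that])
        fix a b c y assume abc: "E a b" "E a c" "E b c" "a \<in> V" "b \<in> V" "c \<in> V"
          and y: "y \<in> V" "y \<noteq> a" "y \<noteq> b" "y \<noteq> c"
        have ne: "a \<noteq> b" "a \<noteq> c" "b \<noteq> c"
          using abc by (metis E_irrefl)+
        have cl: "clique V {a, b, c}"
          using abc E_sym by (simp add: clique_def)
        have at_most_one: False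
          if t: "t \<in> V" "t \<notin> {a, b, c}" and "p \<in> {a, b, c}" "q \<in> {a, b, c}" "p \<noteq> q" "E t p" "E t q"
          for t p q
        proof -
          have "clique V (insert t {a, b, c})"
            using diamond_free_clique_nbrs[OF diamond cl that] t(1) by (intro clique_insert[OF cl])
          then show False
            using K4[of "insert t {a, b, c}"] t(2) ne by simp
        qed
        have two: "\<not> (E y a \<and> E y b)" "\<not> (E y a \<and> E y c)" "\<not> (E y b \<and> E y c)"
          using at_most_one[of y a b] at_most_one[of y a c] at_most_one[of y b c] y ne by auto
        \<comment> \<open>If \<open>y\<close> saw none of the three, a neighbor \<open>z\<close> of
          \<open>y\<close> would have to meet all three edges of the triangle and hence see two of
          its vertices.\<close>
        have "E y a \<or> E y b \<or> E y c"
        proof (rule ccontr)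
          assume none: "\<not> ?thesis"
          have "nbrs V y \<noteq> {}"
            using deg[OF y(1)] K3 by auto
          then obtain z where z: "z \<in> V" "E y z"
            by (auto simp: nbrs_def)
          then have zK: "z \<notin> {a, b, c}"
            using none by auto
          have "E z a \<or> E z b" "E z a \<or> E z c" "E z b \<or> E z c"
            using no_2K2D[OF K2 z(2) abc(1)] no_2K2D[OF K2 z(2) abc(2)] no_2K2D[OF K2 z(2) abc(3)]
              none abc z y by blast+
          then show False
            using at_most_one[OF z(1) zK, of a b] at_most_one[OF z(1) zK, of a c]
              at_most_one[OF z(1) zK, of b c] ne by auto
        qed
        then show "E y a \<and> \<not> E y b \<and> \<not> E y c \<or> \<not> E y a \<and> E y b \<and> \<not> E y c \<or> \<not> E y a \<and> \<not> E y b \<and> E y c"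
          using two by blast
      qed
      have C: "4 \<le> card C"
        using K3 \<open>card K \<le> card D\<close> \<alpha>(3) by simp
      have deg3: "\<forall>x\<in>V. 3 \<le> card (nbrs V x)"
        using deg K3 by (meson le_trans)
      show ?thesis
      proof (cases "\<exists>g. K93 g V")
        case True
        then show ?thesis
          using K93_conn[OF _ step(2) C step(8)] by blast
      next
        case False
        have "indep3_free V"
          by (rule indep3_free_if_no_K93[OF False deg3 abc(4-6,1-3)])
        then show ?thesis
          using indep3_free_conn step(1,2,5) by blast
      qed
    qed
  qed
qed
end

section \<open>Transfer to the graph library\<close>

lemma sgraph_pair_graph:
  assumes "pair_graph G"
  shows "sgraph (\<lambda>u v. (u, v) \<in> parcs G)"
proof -
  interpret pair_graph G by fact
  show ?thesis
  proof
    show "(v, u) \<in> parcs G" if "(u, v) \<in> parcs G" for u v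
      using symD[OF pair_sym_arcs[unfolded symmetric_def with_proj_simps] that] .
    show "(u, u) \<notin> parcs G" for u
      using pair_no_loops[of "(u, u)"] by auto
  qed
qed

lemma has_induced_copyI:
  assumes "pair_graph G" "pair_graph H" and f: "inj_on f (pverts H)" "f ` pverts H \<subseteq> pverts G"
    and arcs: "\<And>i j. i \<in> pverts H \<Longrightarrow> j \<in> pverts H \<Longrightarrow> (i, j) \<in> parcs H \<longleftrightarrow> (f i, f j) \<in> parcs G"
  shows "has_induced_copy G H"
proof -
  interpret G: pair_graph G by fact
  interpret H: pair_graph H by fact
  define S where "S = \<lparr> pverts = f ` pverts H, parcs = map_prod f f ` parcs H \<rparr>"
  define h where "h = \<lparr> iso_verts = f, iso_arcs = map_prod f f, iso_head = snd, iso_tail = fst \<rparr>"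
  have S: "parcs S = {e \<in> parcs G. fst e \<in> pverts S \<and> snd e \<in> pverts S}"
  proof (intro set_eqI iffI)
    fix e assume "e \<in> parcs S"
    then obtain i j where ij: "(i, j) \<in> parcs H" "e = (f i, f j)"
      by (auto simp: S_def)
    then have "i \<in> pverts H" "j \<in> pverts H"
      using H.in_arcsD1 H.in_arcsD2 by metis+
    then show "e \<in> {e \<in> parcs G. fst e \<in> pverts S \<and> snd e \<in> pverts S}"
      using arcs ij by (simp add: S_def)
  next
    fix e assume "e \<in> {e \<in> parcs G. fst e \<in> pverts S \<and> snd e \<in> pverts S}"
    then obtain i j where ij: "i \<in> pverts H" "j \<in> pverts H" "e = (f i, f j)" "e \<in> parcs G"
      by (cases e) (auto simp: S_def)
    then show "e \<in> parcs S"
      using arcs[OF ij(1,2)] by (auto simp: S_def intro: rev_image_eqI)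
  qed
  have "pair_wf_digraph S"
    by unfold_locales (auto simp: S)
  then have "subgraph (with_proj S) (with_proj G)"
    using S f(2) G.wf_digraph_axioms unfolding subgraph_def compatible_def wf_digraph_wp_iff
    by (auto simp: S_def)
  then have ind: "induced_subgraph (with_proj S) (with_proj G)"
    using S by (simp add: induced_subgraph_def)
  have "inj_on (map_prod f f) (parcs H)"
    using f(1) H.in_arcsD1 H.in_arcsD2 by (intro inj_onI) (auto simp: inj_on_eq_iff)
  then have "pre_digraph.digraph_isomorphism (with_proj H) h"
    using f(1) H.wf_digraph_axioms unfolding pre_digraph.digraph_isomorphism_def by (simp add: h_def)
  moreover have "with_proj S = app_iso h (with_proj H)"
    by (simp add: app_iso_def with_proj_def S_def h_def)
  ultimately have "digraph_iso (with_proj H) (with_proj S)"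
    unfolding digraph_iso_def by blast
  with ind show ?thesis
    unfolding has_induced_copy_def by blast
qed

text \<open>The forbidden graphs have initial segments of the naturals as vertex sets, so an
  embedding is a list of distinct vertices of \<open>G\<close> with the image of \<open>i\<close> at
  position \<open>i\<close>.\<close>

lemma has_induced_copy_of_distinct:
  assumes "pair_graph G" "pair_graph H" "\<forall>i\<in>pverts H. i < length xs" "distinct xs" "set xs \<subseteq> pverts G"
    "\<forall>i\<in>pverts H. \<forall>j\<in>pverts H. (i, j) \<in> parcs H \<longleftrightarrow> (xs ! i, xs ! j) \<in> parcs G"
  shows "has_induced_copy G H"
  using assms(3-6) by (intro has_induced_copyI[OF assms(1,2), of "(!) xs"]) (auto simp: inj_on_nth)

section \<open>Forbidden subgraphs and recoloring graphs in terms of the abstract notions\<close>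

context
  fixes G :: "'a pair_pre_digraph"
  assumes G: "pair_graph G"
begin

interpretation sgraph "\<lambda>u v. (u, v) \<in> parcs G"
  by (rule sgraph_pair_graph[OF G])

lemma nonadjacent_sym: "(u, v) \<notin> parcs G \<Longrightarrow> (v, u) \<notin> parcs G"
  using E_sym by blast

lemma no_2K2_if_free:
  assumes "\<not> has_induced_copy G two_K2"
  shows "no_2K2 (pverts G)"
  unfolding no_2K2_def
proof (intro ballI impI, rule ccontr)
  fix a b c d assume V: "a \<in> pverts G" "b \<in> pverts G" "c \<in> pverts G" "d \<in> pverts G"
    and pos: "(a, b) \<in> parcs G" "(c, d) \<in> parcs G"
    and "\<not> ((a, c) \<in> parcs G \<or> (a, d) \<in> parcs G \<or> (b, c) \<in> parcs G \<or> (b, d) \<in> parcs G)"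
  then have neg: "(a, c) \<notin> parcs G" "(a, d) \<notin> parcs G" "(b, c) \<notin> parcs G" "(b, d) \<notin> parcs G"
    by blast+
  then have "distinct [a, b, c, d]"
    using pos E_sym by auto
  then have "has_induced_copy G two_K2"
    using V by (intro has_induced_copy_of_distinct[OF G pair_graph_small(1), of "[a, b, c, d]"])
      (simp_all add: two_K2_def graph_of_def pos pos[THEN E_sym] neg neg[THEN nonadjacent_sym])
  with assms show False ..
qed

lemma triangle_free_if_free:
  assumes "\<not> has_induced_copy G triangle_graph"
  shows "triangle_free (pverts G)"
  unfolding triangle_free_def
proof (intro ballI impI notI)
  fix a b c assume V: "a \<in> pverts G" "b \<in> pverts G" "c \<in> pverts G"
    and pos: "(a, b) \<in> parcs G" "(a, c) \<in> parcs G" "(b, c) \<in> parcs G"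
  then have "distinct [a, b, c]"
    by auto
  then have "has_induced_copy G triangle_graph"
    using V by (intro has_induced_copy_of_distinct[OF G pair_graph_small(2), of "[a, b, c]"])
      (simp_all add: triangle_graph_def graph_of_def pos pos[THEN E_sym])
  with assms show False ..
qed

lemma paw_free_if_free:
  assumes "\<not> has_induced_copy G paw_graph"
  shows "paw_free (pverts G)"
  unfolding paw_free_def
proof (intro ballI impI, rule ccontr)
  fix a b c d assume V: "a \<in> pverts G" "b \<in> pverts G" "c \<in> pverts G" "d \<in> pverts G"
    and pos: "(a, b) \<in> parcs G" "(a, c) \<in> parcs G" "(b, c) \<in> parcs G" "(a, d) \<in> parcs G"
    and "\<not> ((b, d) \<in> parcs G \<or> (c, d) \<in> parcs G)"
  then have neg: "(b, d) \<notin> parcs G" "(c, d) \<notin> parcs G"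
    by blast+
  then have "distinct [a, b, c, d]"
    using pos E_sym by auto
  then have "has_induced_copy G paw_graph"
    using V by (intro has_induced_copy_of_distinct[OF G pair_graph_small(3), of "[a, b, c, d]"])
      (simp_all add: paw_graph_def graph_of_def pos pos[THEN E_sym] neg neg[THEN nonadjacent_sym])
  with assms show False ..
qed

lemma claw_free_if_free:
  assumes "\<not> has_induced_copy G claw_graph"
  shows "claw_free (pverts G)"
  unfolding claw_free_def
proof (intro ballI impI, rule ccontr)
  fix a b c d assume V: "a \<in> pverts G" "b \<in> pverts G" "c \<in> pverts G" "d \<in> pverts G"
    and pos: "(a, b) \<in> parcs G" "(a, c) \<in> parcs G" "(a, d) \<in> parcs G"
    and ne: "b \<noteq> c" "b \<noteq> d" "c \<noteq> d"
    and "\<not> ((b, c) \<in> parcs G \<or> (b, d) \<in> parcs G \<or> (c, d) \<in> parcs G)"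
  then have neg: "(b, c) \<notin> parcs G" "(b, d) \<notin> parcs G" "(c, d) \<notin> parcs G"
    by blast+
  then have "distinct [a, b, c, d]"
    using pos ne by auto
  then have "has_induced_copy G claw_graph"
    using V by (intro has_induced_copy_of_distinct[OF G pair_graph_small(4), of "[a, b, c, d]"])
      (simp_all add: claw_graph_def graph_of_def pos pos[THEN E_sym] neg neg[THEN nonadjacent_sym])
  with assms show False ..
qed

lemma diamond_free_if_free:
  assumes "\<not> has_induced_copy G diamond_graph"
  shows "diamond_free (pverts G)"
  unfolding diamond_free_def
proof (intro ballI impI, rule ccontr)
  fix a b c d assume V: "a \<in> pverts G" "b \<in> pverts G" "c \<in> pverts G" "d \<in> pverts G"
    and pos: "(a, b) \<in> parcs G" "(a, c) \<in> parcs G" "(b, c) \<in> parcs G" "(a, d) \<in> parcs G" "(b, d) \<in> parcs G"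
    and ne: "c \<noteq> d" and neg: "(c, d) \<notin> parcs G"
  then have "distinct [a, b, c, d]"
    by auto
  then have "has_induced_copy G diamond_graph"
    using V by (intro has_induced_copy_of_distinct[OF G pair_graph_small(5), of "[a, b, c, d]"])
      (simp_all add: diamond_graph_def graph_of_def pos pos[THEN E_sym] neg neg[THEN nonadjacent_sym])
  with assms show False ..
qed

lemma col_colorings: "c \<in> colorings k G \<Longrightarrow> col (pverts G) {1..k} c"
  by (intro colI) (auto simp: colorings_def)

lemma restrict_colorings:
  assumes "col (pverts G) {1..k} c"
  shows "restrict c (pverts G) \<in> colorings k G"
proof -
  interpret pair_graph G
    by (rule G)
  have "restrict c (pverts G) u \<noteq> restrict c (pverts G) v" if "(u, v) \<in> parcs G" for u v
    using col_neq[OF assms _ _ that] in_arcsD1[OF that] in_arcsD2[OF that] by simp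
  moreover have "restrict c (pverts G) \<in> pverts G \<rightarrow>\<^sub>E {1..k}"
    using colD[OF assms] by (simp only: restrict_PiE_iff) simp
  ultimately show ?thesis
    unfolding colorings_def by blast
qed

text \<open>A step may leave the restricted coloring unchanged, whereas an arc of the recoloring
  graph changes exactly one vertex. Idle steps are skipped and every other step is an arc.\<close>

lemma reachable_recoloring_graph:
  assumes "reach (pverts G) {1..k} c d" "col (pverts G) {1..k} c"
  shows "restrict c (pverts G) \<rightarrow>\<^sup>*\<^bsub>with_proj (recoloring_graph k G)\<^esub> restrict d (pverts G)"
proof -
  interpret R: pair_graph "recoloring_graph k G"
    by (rule pair_graph_recoloring_graph[OF G])
  define r where "r c = restrict c (pverts G)" for c :: "'a \<Rightarrow> nat"
  have r: "r c \<in> colorings k G" if "col (pverts G) {1..k} c" for c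
    using restrict_colorings[OF that] unfolding r_def .
  have "r c \<rightarrow>\<^sup>*\<^bsub>with_proj (recoloring_graph k G)\<^esub> r d"
    using assms(1)
  proof (induction rule: rtranclp_induct)
    case base
    then show ?case
      using r[OF assms(2)] by (intro R.reachable_refl) (simp add: recoloring_graph_def)
  next
    case (step d e)
    obtain v where cols: "r d \<in> colorings k G" "r e \<in> colorings k G"
      and v: "\<forall>u\<in>pverts G. u \<noteq> v \<longrightarrow> d u = e u"
      using step.hyps(2) r unfolding step_def by blast
    show ?case
    proof (cases "r d = r e")
      case True
      then show ?thesis
        using step.IH by simp
    next
      case False
      then obtain u where u: "u \<in> pverts G" "d u \<noteq> e u"
        unfolding r_def by (metis restrict_ext)
      then have "w = u" if "w \<in> pverts G" "d w \<noteq> e w" for w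
        using v that by metis
      then have "\<exists>!u. u \<in> pverts G \<and> d u \<noteq> e u"
        using u by blast
      moreover have "(u \<in> pverts G \<and> r d u \<noteq> r e u) \<longleftrightarrow> (u \<in> pverts G \<and> d u \<noteq> e u)" for u
        by (auto simp: r_def)
      ultimately have "\<exists>!u. u \<in> pverts G \<and> r d u \<noteq> r e u"
        by simp
      then have "(r d, r e) \<in> parcs (recoloring_graph k G)"
        using cols by (simp add: recoloring_graph_def)
      then show ?thesis
        using R.reachable_adj_trans[OF step.IH] by simp
    qed
  qed
  then show ?thesis
    unfolding r_def .
qed

lemma recolorable_if_conn:
  assumes "\<And>C. finite C \<Longrightarrow> excess (pverts G) C \<Longrightarrow> conn (pverts G) C"
  shows "recolorable G"
  unfolding recolorable_def
proof (intro allI impI)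
  fix l assume l: "chromatic_number G + 1 \<le> l"
  interpret R: pair_graph "recoloring_graph l G"
    by (rule pair_graph_recoloring_graph[OF G])
  obtain c where c: "c \<in> colorings (chromatic_number G) G"
    using colorings_chromatic_number[OF G] by blast
  \<comment> \<open>The color \<open>l\<close> is the spare one over a coloring with \<chi>
    colors.\<close>
  have "l \<in> {1..l}" "l \<notin> {1..chromatic_number G}" "{1..chromatic_number G} \<subseteq> {1..l}"
    using l by auto
  then have sub: "{1..chromatic_number G} \<subset> {1..l}"
    by blast
  then have "excess (pverts G) {1..l}"
    using col_colorings[OF c] unfolding excess_def by blast
  then have conn: "conn (pverts G) {1..l}"
    by (intro assms) simp_all
  \<comment> \<open>Connectedness of the recoloring graph includes that it has a vertex.\<close>
  have "restrict c (pverts G) \<in> colorings l G"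
    using restrict_colorings[OF col_subset[OF col_colorings[OF c]]] sub by blast
  then have "pverts (recoloring_graph l G) \<noteq> {}"
    by (auto simp: recoloring_graph_def)
  moreover have "c \<rightarrow>\<^sup>*\<^bsub>with_proj (recoloring_graph l G)\<^esub> d"
    if "c \<in> colorings l G" "d \<in> colorings l G" for c d
  proof -
    have "restrict c (pverts G) = c" "restrict d (pverts G) = d"
      using that by (auto simp: colorings_def PiE_restrict)
    then show ?thesis
      using reachable_recoloring_graph[of l c d] conn col_colorings that unfolding conn_def by metis
  qed
  ultimately show "Digraph_Component.connected (with_proj (recoloring_graph l G))"
    unfolding connected_def
    by (intro strongly_connectedI R.reachable_mk_symmetricI) (simp_all add: recoloring_graph_def)
qed

end

theorem theorem2:
  fixes G :: "'a pair_pre_digraph" and H :: "nat pair_pre_digraph"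
  assumes "pair_graph G"
    and "H \<in> {triangle_graph, paw_graph, claw_graph, diamond_graph}"
    and "free_of {two_K2, H} G"
  shows "recolorable G"
proof (rule recolorable_if_conn[OF assms(1)])
  interpret sgraph "\<lambda>u v. (u, v) \<in> parcs G"
    by (rule sgraph_pair_graph[OF assms(1)])
  have fin: "finite (pverts G)"
    using assms(1) by (simp add: pair_graph_def pair_digraph_def pair_fin_digraph_def pair_fin_digraph_axioms_def)
  have K2: "no_2K2 (pverts G)"
    using no_2K2_if_free[OF assms(1)] assms(3) by (simp add: free_of_def)
  have H: "\<not> has_induced_copy G H"
    using assms(3) by (simp add: free_of_def)
  fix C assume C: "finite C" "excess (pverts G) C"
  show "conn (pverts G) C"
    using assms(2)
  proof (elim insertE emptyE)
    assume "H = triangle_graph"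
    then show ?thesis
      using triangle_free_conn[OF fin C(1) _ C(2)] triangle_free_if_free[OF assms(1)] K2 H by simp
  next
    assume "H = paw_graph"
    then show ?thesis
      using paw_free_conn[OF fin C(1) _ C(2)] paw_free_if_free[OF assms(1)] K2 H by simp
  next
    assume "H = claw_graph"
    then show ?thesis
      using claw_free_conn[OF fin C(1) _ C(2)] claw_free_if_free[OF assms(1)] K2 H by simp
  next
    assume "H = diamond_graph"
    then show ?thesis
      using diamond_free_conn[OF fin C(1) _ C(2)] diamond_free_if_free[OF assms(1)] K2 H by simp
  qed
qed

end
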